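(* $\exists\mathbb{R}^{<}_{\exp}\subseteq\Sigma^0_1$ and $\exists\mathbb{R}_{\exp}\subseteq\Sigma^0_3$.
   Context: $\mathbb{R}_{\exp}$ is the structure $(\mathbb{R},+,\times,<,=,0,1,\exp)$ and $\mathbb{R}^<_{\exp}$ is $(\mathbb{R},+,\times,<,0,1,\exp)$ (no equality). $\exists\mathbb{R}_{\exp}$ is the class of decision problems polynomial-time many-one reducible to the set of existential sentences (built from atoms $t<t'$, $t=t'$ using only $\land,\lor,\exists$) true in $\mathbb{R}_{\exp}$; $\exists\mathbb{R}^{<}_{\exp}$ is defined the same way with sentences not using equality, true in $\mathbb{R}^<_{\exp}$. $\Sigma^0_k$ denotes the $k$-th existential level of the arithmetical hierarchy ($\Sigma^0_1$ = recursively enumerable sets). *)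

theory Defs
  imports Complex_Main "HOL-Computational_Algebra.Polynomial"
begin

section \<open>Existential sentences over the real exponential field\<close>

datatype tm =
    Var nat
  | Zero
  | One
  | Add tm tm
  | Mul tm tm
  | Exp tm

datatype fm =
    Less tm tm
  | Eql tm tm
  | And fm fm
  | Or fm fm
  | Exi nat fm

primrec tm_val :: "(nat \<Rightarrow> real) \<Rightarrow> tm \<Rightarrow> real" where
  "tm_val e (Var i) = e i"
| "tm_val e Zero = 0"
| "tm_val e One = 1"
| "tm_val e (Add s t) = tm_val e s + tm_val e t"
| "tm_val e (Mul s t) = tm_val e s * tm_val e t"
| "tm_val e (Exp t) = exp (tm_val e t)"

primrec fm_holds :: "(nat \<Rightarrow> real) \<Rightarrow> fm \<Rightarrow> bool" where
  "fm_holds e (Less s t) \<longleftrightarrow> tm_val e s < tm_val e t"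
| "fm_holds e (Eql s t) \<longleftrightarrow> tm_val e s = tm_val e t"
| "fm_holds e (And p q) \<longleftrightarrow> fm_holds e p \<and> fm_holds e q"
| "fm_holds e (Or p q) \<longleftrightarrow> fm_holds e p \<or> fm_holds e q"
| "fm_holds e (Exi i p) \<longleftrightarrow> (\<exists>x. fm_holds (e(i := x)) p)"

primrec tm_vars :: "tm \<Rightarrow> nat set" where
  "tm_vars (Var i) = {i}"
| "tm_vars Zero = {}"
| "tm_vars One = {}"
| "tm_vars (Add s t) = tm_vars s \<union> tm_vars t"
| "tm_vars (Mul s t) = tm_vars s \<union> tm_vars t"
| "tm_vars (Exp t) = tm_vars t"

primrec fm_free :: "fm \<Rightarrow> nat set" where
  "fm_free (Less s t) = tm_vars s \<union> tm_vars t"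
| "fm_free (Eql s t) = tm_vars s \<union> tm_vars t"
| "fm_free (And p q) = fm_free p \<union> fm_free q"
| "fm_free (Or p q) = fm_free p \<union> fm_free q"
| "fm_free (Exi i p) = fm_free p - {i}"

primrec eq_free :: "fm \<Rightarrow> bool" where
  "eq_free (Less s t) \<longleftrightarrow> True"
| "eq_free (Eql s t) \<longleftrightarrow> False"
| "eq_free (And p q) \<longleftrightarrow> eq_free p \<and> eq_free q"
| "eq_free (Or p q) \<longleftrightarrow> eq_free p \<and> eq_free q"
| "eq_free (Exi i p) \<longleftrightarrow> eq_free p"

definition sentence :: "fm \<Rightarrow> bool" where
  "sentence p \<longleftrightarrow> fm_free p = {}"

text \<open>The value of a sentence does not depend on the assignment.\<close>

definition true_sentence :: "fm \<Rightarrow> bool" where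
  "true_sentence p \<longleftrightarrow> sentence p \<and> (\<forall>e. fm_holds e p)"


section \<open>Sentences as bit strings\<close>

text \<open>Sentences are written in prefix notation with a three-bit tag per symbol. Term and
  formula tags overlap, but the syntactic category is known at every position. A variable
  is named by its index in binary (least significant bit first), each digit being preceded
  by a continuation bit, so that the length is logarithmic in the index.\<close>

fun bin_digits :: "nat \<Rightarrow> bool list" where
  "bin_digits n = (if n = 0 then [] else odd n # bin_digits (n div 2))"

declare bin_digits.simps [simp del]

definition idx_code :: "nat \<Rightarrow> bool list" where
  "idx_code n = concat (map (\<lambda>b. [True, b]) (bin_digits n)) @ [False]"

primrec tm_code :: "tm \<Rightarrow> bool list" where
  "tm_code (Var i) = [False, False, False] @ idx_code i"
| "tm_code Zero = [False, False, True]"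
| "tm_code One = [False, True, False]"
| "tm_code (Add s t) = [False, True, True] @ tm_code s @ tm_code t"
| "tm_code (Mul s t) = [True, False, False] @ tm_code s @ tm_code t"
| "tm_code (Exp t) = [True, False, True] @ tm_code t"

primrec fm_code :: "fm \<Rightarrow> bool list" where
  "fm_code (Less s t) = [False, False, False] @ tm_code s @ tm_code t"
| "fm_code (Eql s t) = [False, False, True] @ tm_code s @ tm_code t"
| "fm_code (And p q) = [False, True, False] @ fm_code p @ fm_code q"
| "fm_code (Or p q) = [False, True, True] @ fm_code p @ fm_code q"
| "fm_code (Exi i p) = [True, False, False] @ idx_code i @ fm_code p"

lemma bin_digits_inj: "bin_digits m = bin_digits n \<Longrightarrow> m = n"
proof (induction m arbitrary: n rule: less_induct)
  case (less m)
  show ?case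
  proof (cases "m = 0 \<or> n = 0")
    case True
    then show ?thesis
      using less.prems bin_digits.simps[of m] bin_digits.simps[of n]
      by (auto split: if_splits)
  next
    case False
    then have "odd m = odd n" and "bin_digits (m div 2) = bin_digits (n div 2)"
      using less.prems bin_digits.simps[of m] bin_digits.simps[of n] by auto
    moreover from this(2) have "m div 2 = n div 2"
      using less.IH False by auto
    ultimately show ?thesis
      by (metis even_two_times_div_two odd_two_times_div_two_succ)
  qed
qed

lemma idx_code_prefix_free:
  "idx_code m @ xs = idx_code n @ ys \<Longrightarrow> m = n \<and> xs = ys"
proof -
  have aux: "concat (map (\<lambda>b. [True, b]) bs) @ False # xs
      = concat (map (\<lambda>b. [True, b]) cs) @ False # ys \<Longrightarrow> bs = cs \<and> xs = ys" for bs cs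
  proof (induction bs arbitrary: cs)
    case Nil
    then show ?case by (cases cs) auto
  next
    case (Cons b bs)
    then show ?case by (cases cs) auto
  qed
  assume "idx_code m @ xs = idx_code n @ ys"
  then show ?thesis
    using aux[of "bin_digits m" "bin_digits n"] bin_digits_inj[of m n]
    by (simp add: idx_code_def)
qed

lemma tm_code_prefix_free:
  "tm_code s @ xs = tm_code t @ ys \<Longrightarrow> s = t \<and> xs = ys"
proof (induction s arbitrary: t xs ys)
  case (Var i)
  then show ?case by (cases t) (auto dest: idx_code_prefix_free)
next
  case Zero
  then show ?case by (cases t) auto
next
  case One
  then show ?case by (cases t) auto
next
  case (Add s1 s2)
  show ?case
  proof (cases t)
    case (Add t1 t2)
    with Add.prems have eq: "tm_code s1 @ tm_code s2 @ xs = tm_code t1 @ tm_code t2 @ ys" by simp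
    then have "s1 = t1" and eq2: "tm_code s2 @ xs = tm_code t2 @ ys"
      using Add.IH(1)[OF eq] by simp_all
    with Add Add.IH(2)[OF eq2] show ?thesis by simp
  qed (use Add.prems in simp_all)
next
  case (Mul s1 s2)
  show ?case
  proof (cases t)
    case (Mul t1 t2)
    with Mul.prems have eq: "tm_code s1 @ tm_code s2 @ xs = tm_code t1 @ tm_code t2 @ ys" by simp
    then have "s1 = t1" and eq2: "tm_code s2 @ xs = tm_code t2 @ ys"
      using Mul.IH(1)[OF eq] by simp_all
    with Mul Mul.IH(2)[OF eq2] show ?thesis by simp
  qed (use Mul.prems in simp_all)
next
  case (Exp s1)
  show ?case
  proof (cases t)
    case (Exp t1)
    with Exp.prems have eq: "tm_code s1 @ xs = tm_code t1 @ ys" by simp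
    with Exp Exp.IH[OF eq] show ?thesis by simp
  qed (use Exp.prems in simp_all)
qed

lemma fm_code_prefix_free:
  "fm_code p @ xs = fm_code q @ ys \<Longrightarrow> p = q \<and> xs = ys"
proof (induction p arbitrary: q xs ys)
  case (Less s t)
  show ?case
  proof (cases q)
    case (Less s' t')
    with Less.prems have eq: "tm_code s @ tm_code t @ xs = tm_code s' @ tm_code t' @ ys" by simp
    then have "s = s'" and eq2: "tm_code t @ xs = tm_code t' @ ys"
      using tm_code_prefix_free[OF eq] by simp_all
    with Less tm_code_prefix_free[OF eq2] show ?thesis by simp
  qed (use Less.prems in simp_all)
next
  case (Eql s t)
  show ?case
  proof (cases q)
    case (Eql s' t')
    with Eql.prems have eq: "tm_code s @ tm_code t @ xs = tm_code s' @ tm_code t' @ ys" by simp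
    then have "s = s'" and eq2: "tm_code t @ xs = tm_code t' @ ys"
      using tm_code_prefix_free[OF eq] by simp_all
    with Eql tm_code_prefix_free[OF eq2] show ?thesis by simp
  qed (use Eql.prems in simp_all)
next
  case (And p1 p2)
  show ?case
  proof (cases q)
    case (And q1 q2)
    with And.prems have eq: "fm_code p1 @ fm_code p2 @ xs = fm_code q1 @ fm_code q2 @ ys" by simp
    then have "p1 = q1" and eq2: "fm_code p2 @ xs = fm_code q2 @ ys"
      using And.IH(1)[OF eq] by simp_all
    with And And.IH(2)[OF eq2] show ?thesis by simp
  qed (use And.prems in simp_all)
next
  case (Or p1 p2)
  show ?case
  proof (cases q)
    case (Or q1 q2)
    with Or.prems have eq: "fm_code p1 @ fm_code p2 @ xs = fm_code q1 @ fm_code q2 @ ys" by simp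
    then have "p1 = q1" and eq2: "fm_code p2 @ xs = fm_code q2 @ ys"
      using Or.IH(1)[OF eq] by simp_all
    with Or Or.IH(2)[OF eq2] show ?thesis by simp
  qed (use Or.prems in simp_all)
next
  case (Exi i p1)
  show ?case
  proof (cases q)
    case (Exi j q1)
    with Exi.prems have eq: "idx_code i @ fm_code p1 @ xs = idx_code j @ fm_code q1 @ ys" by simp
    then have "i = j" and eq2: "fm_code p1 @ xs = fm_code q1 @ ys"
      using idx_code_prefix_free[OF eq] by simp_all
    with Exi Exi.IH[OF eq2] show ?thesis by simp
  qed (use Exi.prems in simp_all)
qed

lemma inj_fm_code: "inj fm_code"
  by (rule injI) (use fm_code_prefix_free[where xs = "[]" and ys = "[]"] in simp)

definition ETR_exp :: "bool list set" where
  "ETR_exp = {fm_code p |p. true_sentence p}"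

definition ETR_exp_less :: "bool list set" where
  "ETR_exp_less = {fm_code p |p. eq_free p \<and> true_sentence p}"


section \<open>Polynomial-time many-one reductions\<close>

text \<open>Deterministic Turing machines with one two-way infinite tape. Symbol \<open>0\<close> is the blank,
  symbols \<open>1\<close> and \<open>2\<close> are the input and output bits.\<close>

datatype move = Go_Left | Go_Right

record turing_machine =
  num_states :: nat
  num_symbols :: nat
  start_state :: nat
  halt_state :: nat
  trans_fun :: "nat \<Rightarrow> nat \<Rightarrow> nat \<times> nat \<times> move"

definition wf_machine :: "turing_machine \<Rightarrow> bool" where
  "wf_machine M \<longleftrightarrow>
     3 \<le> num_symbols M \<and> start_state M < num_states M \<and> halt_state M < num_states M \<and>
     (\<forall>q < num_states M. \<forall>a < num_symbols M.
        case trans_fun M q a of (q', a', d) \<Rightarrow> q' < num_states M \<and> a' < num_symbols M)"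

text \<open>A configuration consists of the state, the tape to the left of the head (nearest cell
  first), and the tape from the head onwards; cells beyond the end of either list are blank.\<close>

type_synonym config = "nat \<times> nat list \<times> nat list"

definition first_cell :: "nat list \<Rightarrow> nat" where
  "first_cell cs = (case cs of [] \<Rightarrow> 0 | a # _ \<Rightarrow> a)"

fun machine_step :: "turing_machine \<Rightarrow> config \<Rightarrow> config" where
  "machine_step M (q, l, r) =
     (if q = halt_state M then (q, l, r)
      else case trans_fun M q (first_cell r) of
        (q', a, Go_Left) \<Rightarrow> (q', tl l, first_cell l # a # tl r)
      | (q', a, Go_Right) \<Rightarrow> (q', a # l, tl r))"

definition bit_symbol :: "bool \<Rightarrow> nat" where
  "bit_symbol b = (if b then 2 else 1)"

definition init_config :: "turing_machine \<Rightarrow> bool list \<Rightarrow> config" where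
  "init_config M w = (start_state M, [], map bit_symbol w)"

text \<open>The output is the string from the head up to the first blank.\<close>

definition halts_with :: "turing_machine \<Rightarrow> config \<Rightarrow> bool list \<Rightarrow> bool" where
  "halts_with M c v \<longleftrightarrow>
     (\<exists>l r. c = (halt_state M, l, map bit_symbol v @ r) \<and> first_cell r = 0)"

definition polytime :: "(bool list \<Rightarrow> bool list) \<Rightarrow> bool" where
  "polytime f \<longleftrightarrow>
     (\<exists>M (p :: nat poly). wf_machine M \<and>
        (\<forall>w. \<exists>n \<le> poly p (length w). halts_with M ((machine_step M ^^ n) (init_config M w)) (f w)))"

definition polytime_reducible :: "bool list set \<Rightarrow> bool list set \<Rightarrow> bool" where
  "polytime_reducible A B \<longleftrightarrow> (\<exists>f. polytime f \<and> (\<forall>w. w \<in> A \<longleftrightarrow> f w \<in> B))"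

definition exists_R_exp :: "bool list set set" where
  "exists_R_exp = {A. polytime_reducible A ETR_exp}"

definition exists_R_exp_less :: "bool list set set" where
  "exists_R_exp_less = {A. polytime_reducible A ETR_exp_less}"


section \<open>The arithmetical hierarchy\<close>

text \<open>Total recursive functions of arity \<open>n\<close>, with minimization restricted to regular
  functions. Only the values on lists of length \<open>n\<close> are meaningful.\<close>

inductive recursive_fun :: "nat \<Rightarrow> (nat list \<Rightarrow> nat) \<Rightarrow> bool" where
  zero: "recursive_fun n (\<lambda>xs. 0)"
| succ: "recursive_fun 1 (\<lambda>xs. Suc (hd xs))"
| proj: "i < n \<Longrightarrow> recursive_fun n (\<lambda>xs. xs ! i)"
| comp: "recursive_fun (length gs) f \<Longrightarrow> \<forall>g \<in> set gs. recursive_fun n g \<Longrightarrow>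
    recursive_fun n (\<lambda>xs. f (map (\<lambda>g. g xs) gs))"
| prim_rec: "recursive_fun n f \<Longrightarrow> recursive_fun (n + 2) g \<Longrightarrow>
    recursive_fun (n + 1) (\<lambda>xs. rec_nat (f (tl xs)) (\<lambda>k r. g (k # r # tl xs)) (hd xs))"
| mu: "recursive_fun (n + 1) f \<Longrightarrow> \<forall>xs. length xs = n \<longrightarrow> (\<exists>y. f (y # xs) = 0) \<Longrightarrow>
    recursive_fun n (\<lambda>xs. LEAST y. f (y # xs) = 0)"

definition recursive_rel :: "nat \<Rightarrow> (nat list \<Rightarrow> bool) \<Rightarrow> bool" where
  "recursive_rel n R \<longleftrightarrow>
     (\<exists>f. recursive_fun n f \<and> (\<forall>xs. length xs = n \<longrightarrow> f xs = (if R xs then 1 else 0)))"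

text \<open>\<open>Sigma_rel k n R\<close>: the \<open>n\<close>-ary relation \<open>R\<close> is $\Sigma^0_k$. A relation is
  $\Sigma^0_{k+1}$ iff it is the projection of a $\Pi^0_k$ relation \<open>P\<close>, that is, of one
  whose complement is $\Sigma^0_k$.\<close>

primrec Sigma_rel :: "nat \<Rightarrow> nat \<Rightarrow> (nat list \<Rightarrow> bool) \<Rightarrow> bool" where
  "Sigma_rel 0 n R \<longleftrightarrow> recursive_rel n R"
| "Sigma_rel (Suc k) n R \<longleftrightarrow>
     (\<exists>P. Sigma_rel k (Suc n) (\<lambda>xs. \<not> P xs) \<and>
          (\<forall>xs. length xs = n \<longrightarrow> (R xs \<longleftrightarrow> (\<exists>y. P (y # xs)))))"

text \<open>Bit strings are identified with natural numbers through bijective base-2 numeration.\<close>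

primrec str_code :: "bool list \<Rightarrow> nat" where
  "str_code [] = 0"
| "str_code (b # w) = 2 * str_code w + (if b then 2 else 1)"

lemma bij_str_code: "bij str_code"
proof (rule bijI)
  show "inj str_code"
  proof (rule injI)
    fix v w show "str_code v = str_code w \<Longrightarrow> v = w"
    proof (induction v arbitrary: w)
      case Nil
      then show ?case by (cases w) (simp_all split: if_splits)
    next
      case (Cons b v)
      then obtain c u where w: "w = c # u"
        by (cases w) (simp_all split: if_splits)
      have eq: "2 * str_code v + (if b then 2 else 1) = 2 * str_code u + (if c then 2 else 1)"
        using Cons.prems w by simp
      then have "b = c \<and> str_code v = str_code u"
        by (cases b; cases c) (simp_all, presburger+)
      then show ?case using Cons.IH[of u] w by simp
    qed
  qed
  have "\<exists>w. str_code w = n" for n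
  proof (induction n rule: less_induct)
    case (less n)
    show ?case
    proof (cases "n = 0")
      case True
      then show ?thesis by (intro exI[of _ "[]"]) simp
    next
      case False
      then have "(n - 1) div 2 < n" by presburger
      then obtain w where w: "str_code w = (n - 1) div 2"
        using less.IH[of "(n - 1) div 2"] by force
      have "str_code (even n # w) = n"
      proof (cases "even n")
        case True
        then have "2 * ((n - 1) div 2) + 2 = n" using False by presburger
        with True w show ?thesis by simp
      next
        case odd: False
        then have "2 * ((n - 1) div 2) + 1 = n" by presburger
        with odd w show ?thesis by simp
      qed
      then show ?thesis ..
    qed
  qed
  then show "surj str_code" by (metis surjI)
qed

definition Sigma_class :: "nat \<Rightarrow> bool list set set" where
  "Sigma_class k = {A. Sigma_rel k 1 (\<lambda>xs. hd xs \<in> str_code ` A)}"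

end

theory Submission
  imports Defs "HOL-Library.Nat_Bijection"
begin

text \<open>A sentence \<open>p\<close> has approximations \<open>approx N M\<close>: quantifiers range over rationals
  of absolute value below \<open>N + 1\<close>, an equation may fail by less than \<open>1 / (M + 1)\<close>, and
  \<open>s < t\<close> becomes \<open>s + 1 / (N + 1) < t + 1 / (M + 1)\<close>. By continuity a true sentence has an
  \<open>N\<close> such that all approximations in \<open>M\<close> hold; conversely, compactness of the bounded boxes
  turns approximate solutions for all \<open>M\<close> into an exact one, so truth is
  \<open>\<exists>N. \<forall>M. approx N M\<close>. For \<open>M = N\<close> the corrections of an inequality cancel, and for sentences
  without equality truth is \<open>\<exists>N. approx N N\<close>. The approximations themselves are recursively
  enumerable, because rational enclosures of the values of exponential terms can be enumerated, using
  \<open>(1 + x / n) ^ n \<le> exp x\<close>. Finally, a polynomial-time reduction has a recursively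
  enumerable graph, and as it is a function, the quantifier over its value can be placed innermost.

  Recursive enumerability is derived from a single principle: a predicate is recursively enumerable
  if it is generated by a recursively enumerable set of rules along which some measure decreases.\<close>

text \<open>No equality test for values of exponential terms is available, but a strict inequality
  between two such values is confirmed by finite rational enclosures. Hence every atom of
  \<open>approx\<close> is strict, even the one standing for an equation, and \<open>approx\<close>
  is semidecidable. The obstacle is that limits weaken \<open><\<close> to \<open>\<le>\<close>; the
  gap 1 / (N + 1), which stays fixed while M grows, restores strictness in the limit. The same N
  bounds the quantifiers: enlarging N relaxes both conditions, so the parameters found for the two
  halves of a conjunction merge by taking the maximum. Since \<open>approx\<close> is recursively
  enumerable and not claimed to be decidable, the universal quantifier over M in front of it gives a
  Pi_2 condition and the existential one over N leads to the third level; without equality the two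
  existential searches, for N and for a derivation, stay on the first.\<close>

section \<open>Recursive functions\<close>

text \<open>Closes \<open>recursive_fun\<close> under changing the meaningless values on lists of the wrong length.\<close>

definition rfun :: "nat \<Rightarrow> (nat list \<Rightarrow> nat) \<Rightarrow> bool" where
  "rfun n f \<longleftrightarrow> (\<exists>g. recursive_fun n g \<and> (\<forall>xs. length xs = n \<longrightarrow> f xs = g xs))"

lemma rfun_cong: "rfun n g \<Longrightarrow> (\<And>xs. length xs = n \<Longrightarrow> f xs = g xs) \<Longrightarrow> rfun n f"
  unfolding rfun_def by auto

lemma rfun_comp:
  assumes f: "rfun (length gs) f" and gs: "\<forall>g \<in> set gs. rfun n g"
  shows "rfun n (\<lambda>xs. f (map (\<lambda>g. g xs) gs))"
proof -
  obtain f' where f': "recursive_fun (length gs) f'" "\<forall>xs. length xs = length gs \<longrightarrow> f xs = f' xs"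
    using f unfolding rfun_def by auto
  from gs obtain G where G: "\<forall>g \<in> set gs. recursive_fun n (G g) \<and> (\<forall>xs. length xs = n \<longrightarrow> g xs = G g xs)"
    unfolding rfun_def by metis
  have "recursive_fun n (\<lambda>xs. f' (map (\<lambda>g. g xs) (map G gs)))"
    by (rule recursive_fun.comp) (use f' G in auto)
  moreover have "f (map (\<lambda>g. g xs) gs) = f' (map (\<lambda>g. g xs) (map G gs))" if "length xs = n" for xs
  proof -
    have "map (\<lambda>g. g xs) gs = map (\<lambda>g. g xs) (map G gs)"
      using G that by auto
    then show ?thesis using f'(2) by (metis length_map)
  qed
  ultimately show ?thesis unfolding rfun_def by blast
qed

lemma rfun_comp1: "rfun 1 f \<Longrightarrow> rfun n a \<Longrightarrow> rfun n (\<lambda>xs. f [a xs])"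
  using rfun_comp[of "[a]" f n] by simp

lemma rfun_comp2: "rfun 2 f \<Longrightarrow> rfun n a \<Longrightarrow> rfun n b \<Longrightarrow> rfun n (\<lambda>xs. f [a xs, b xs])"
  using rfun_comp[of "[a, b]" f n] by (simp add: numeral_2_eq_2)

lemma rfun_nth: "i < n \<Longrightarrow> rfun n (\<lambda>xs. xs ! i)"
  unfolding rfun_def using recursive_fun.proj by blast

lemma rfun_hd: "0 < n \<Longrightarrow> rfun n hd"
  by (rule rfun_cong[OF rfun_nth[of 0]]) (auto simp: hd_conv_nth)

lemma rfun_Suc: "rfun n a \<Longrightarrow> rfun n (\<lambda>xs. Suc (a xs))"
  using rfun_comp1[of "\<lambda>xs. Suc (hd xs)" n a] recursive_fun.succ
  unfolding rfun_def by auto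

lemma rfun_zero: "rfun n (\<lambda>xs. 0)"
  unfolding rfun_def using recursive_fun.zero by blast

lemma rfun_const: "rfun n (\<lambda>xs. c)"
  by (induction c) (auto intro: rfun_zero rfun_Suc)

lemma rfun_prim_rec:
  assumes "rfun n f" and "rfun (n + 2) g"
  shows "rfun (Suc n) (\<lambda>xs. rec_nat (f (tl xs)) (\<lambda>k r. g (k # r # tl xs)) (hd xs))"
proof -
  obtain f' where f': "recursive_fun n f'" "\<forall>xs. length xs = n \<longrightarrow> f xs = f' xs"
    using assms unfolding rfun_def by auto
  obtain g' where g': "recursive_fun (n + 2) g'" "\<forall>xs. length xs = n + 2 \<longrightarrow> g xs = g' xs"
    using assms unfolding rfun_def by auto
  have "rec_nat (f (tl xs)) (\<lambda>k r. g (k # r # tl xs)) m = rec_nat (f' (tl xs)) (\<lambda>k r. g' (k # r # tl xs)) m"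
    if "length xs = Suc n" for xs m
    using that by (induction m) (auto simp: f' g')
  with recursive_fun.prim_rec[OF f'(1) g'(1)] show ?thesis
    unfolding rfun_def
    by (intro exI[of _ "\<lambda>xs. rec_nat (f' (tl xs)) (\<lambda>k r. g' (k # r # tl xs)) (hd xs)"]) simp
qed

lemma rfun_mu:
  assumes "rfun (Suc n) f" and "\<And>xs. length xs = n \<Longrightarrow> \<exists>y. f (y # xs) = 0"
  shows "rfun n (\<lambda>xs. LEAST y. f (y # xs) = 0)"
proof -
  obtain f' where f': "recursive_fun (n + 1) f'" "\<forall>xs. length xs = Suc n \<longrightarrow> f xs = f' xs"
    using assms(1) unfolding rfun_def by auto
  have "recursive_fun n (\<lambda>xs. LEAST y. f' (y # xs) = 0)"
    by (rule recursive_fun.mu[OF f'(1)]) (use assms(2) f'(2) in auto)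
  then show ?thesis unfolding rfun_def using f'(2) by fastforce
qed

lemma rfun_add:
  assumes "rfun n a" and "rfun n b"
  shows "rfun n (\<lambda>xs. a xs + b xs)"
proof -
  \<comment> \<open>The arguments are kept as positions of the extended list, the form that
    \<open>rfun_nth\<close> recognises; hence the deleted simp rules.\<close>
  have "rfun (Suc 1) (\<lambda>xs. rec_nat (tl xs ! 0) (\<lambda>k r. Suc ((k # r # tl xs) ! 1)) (hd xs))"
    by (rule rfun_prim_rec) (auto intro!: rfun_Suc rfun_nth simp del: nth_Cons_Suc)
  then have "rfun 2 (\<lambda>xs. rec_nat (tl xs ! 0) (\<lambda>k r. Suc ((k # r # tl xs) ! 1)) (hd xs))"
    by (simp add: numeral_2_eq_2)
  moreover have "rec_nat y (\<lambda>k r. Suc r) x = x + y" for x y by (induction x) auto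
  ultimately show ?thesis using rfun_comp2 assms by fastforce
qed

lemma rfun_mult:
  assumes "rfun n a" and "rfun n b"
  shows "rfun n (\<lambda>xs. a xs * b xs)"
proof -
  have "rfun (Suc 1) (\<lambda>xs. rec_nat 0 (\<lambda>k r. (k # r # tl xs) ! 1 + (k # r # tl xs) ! 2) (hd xs))"
    by (rule rfun_prim_rec[where f = "\<lambda>_. 0"])
      (auto intro!: rfun_add rfun_nth rfun_zero simp del: nth_Cons_Suc nth_Cons_numeral)
  then have "rfun 2 (\<lambda>xs. rec_nat 0 (\<lambda>k r. (k # r # tl xs) ! 1 + (k # r # tl xs) ! 2) (hd xs))"
    by (simp add: numeral_2_eq_2)
  moreover have "rec_nat 0 (\<lambda>k r. r + y) x = x * y" for x y :: nat by (induction x) auto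
  ultimately show ?thesis using rfun_comp2 assms by fastforce
qed

lemma rfun_pred:
  assumes "rfun n a"
  shows "rfun n (\<lambda>xs. a xs - 1)"
proof -
  have "rfun (Suc 0) (\<lambda>xs. rec_nat 0 (\<lambda>k r. (k # r # tl xs) ! 0) (hd xs))"
    by (rule rfun_prim_rec[where f = "\<lambda>_. 0"])
      (auto intro!: rfun_nth rfun_zero simp del: nth_Cons_0)
  then have "rfun 1 (\<lambda>xs. rec_nat 0 (\<lambda>k r. (k # r # tl xs) ! 0) (hd xs))" by simp
  moreover have "rec_nat 0 (\<lambda>k r. k) x = x - 1" for x by (cases x) auto
  ultimately show ?thesis using rfun_comp1 assms by fastforce
qed

lemma rfun_diff:
  assumes "rfun n a" and "rfun n b"
  shows "rfun n (\<lambda>xs. a xs - b xs)"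
proof -
  have "rfun (Suc 1) (\<lambda>xs. rec_nat (tl xs ! 0) (\<lambda>k r. (k # r # tl xs) ! 1 - 1) (hd xs))"
    by (rule rfun_prim_rec)
      (auto intro!: rfun_pred[unfolded One_nat_def] rfun_nth simp del: nth_Cons_Suc)
  then have "rfun 2 (\<lambda>xs. rec_nat (tl xs ! 0) (\<lambda>k r. (k # r # tl xs) ! 1 - 1) (hd xs))"
    by (simp add: numeral_2_eq_2)
  moreover have "rec_nat y (\<lambda>k r. r - 1) x = y - x" for x y :: nat by (induction x) auto
  \<comment> \<open>The recursion runs over the subtrahend, which comes first, so the operands enter
    in reverse order.\<close>
  ultimately show ?thesis using rfun_comp2[of _ n b a] assms by fastforce
qed

lemma rfun_triangle:
  assumes "rfun n a"
  shows "rfun n (\<lambda>xs. triangle (a xs))"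
proof -
  have "rfun (Suc 0) (\<lambda>xs. rec_nat 0 (\<lambda>k r. (k # r # tl xs) ! 1 + Suc ((k # r # tl xs) ! 0)) (hd xs))"
    by (rule rfun_prim_rec[where f = "\<lambda>_. 0"])
      (auto intro!: rfun_add rfun_Suc rfun_nth rfun_zero simp del: nth_Cons_0 nth_Cons_Suc)
  then have "rfun 1 (\<lambda>xs. rec_nat 0 (\<lambda>k r. (k # r # tl xs) ! 1 + Suc ((k # r # tl xs) ! 0)) (hd xs))" by simp
  moreover have "rec_nat 0 (\<lambda>k r. r + Suc k) x = triangle x" for x by (induction x) auto
  ultimately show ?thesis using rfun_comp1 assms by fastforce
qed

section \<open>The Cantor pairing function and its projections\<close>

definition pair :: "nat \<Rightarrow> nat \<Rightarrow> nat" where "pair m n = prod_encode (m, n)"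
definition pfst :: "nat \<Rightarrow> nat" where "pfst z = fst (prod_decode z)"
definition psnd :: "nat \<Rightarrow> nat" where "psnd z = snd (prod_decode z)"

lemma pfst_pair [simp]: "pfst (pair m n) = m" and psnd_pair [simp]: "psnd (pair m n) = n"
  by (simp_all add: pair_def pfst_def psnd_def)

lemma pair_pfst_psnd [simp]: "pair (pfst z) (psnd z) = z"
  by (simp add: pair_def pfst_def psnd_def)

lemma pair_eq_iff: "pair m n = z \<longleftrightarrow> m = pfst z \<and> n = psnd z"
  by auto

lemma rfun_pair: "rfun n a \<Longrightarrow> rfun n b \<Longrightarrow> rfun n (\<lambda>xs. pair (a xs) (b xs))"
  by (simp add: pair_def prod_encode_def rfun_add rfun_triangle)

text \<open>\<open>pair m n\<close> is \<open>triangle (m + n) + m\<close>, so the antidiagonal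
  \<open>m + n\<close> of a code z is the least s with \<open>z < triangle (Suc s)\<close>.
  Truncated subtraction turns this inequality into an equation with 0, as minimization
  requires.\<close>

definition diagonal :: "nat \<Rightarrow> nat" where
  "diagonal z = (LEAST s. Suc z - triangle (Suc s) = 0)"

lemma triangle_mono: "m \<le> n \<Longrightarrow> triangle m \<le> triangle n"
  by (induction n) (auto simp: le_Suc_eq)

lemma diagonal_pair: "diagonal (pair m n) = m + n"
  unfolding diagonal_def
proof (rule Least_equality)
  show "Suc (pair m n) - triangle (Suc (m + n)) = 0"
    by (simp add: pair_def prod_encode_def)
  fix s assume "Suc (pair m n) - triangle (Suc s) = 0"
  then have "triangle (m + n) < triangle (Suc s)" by (simp add: pair_def prod_encode_def)
  then show "m + n \<le> s" using triangle_mono[of "Suc s" "m + n"] by linarith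
qed

lemma rfun_diagonal:
  assumes "rfun n a"
  shows "rfun n (\<lambda>xs. diagonal (a xs))"
proof -
  have le: "n \<le> triangle n" for n by (induction n) auto
  have "rfun (Suc 1) (\<lambda>xs. Suc (xs ! 1) - triangle (Suc (xs ! 0)))"
    by (intro rfun_diff rfun_Suc rfun_triangle rfun_nth) auto
  then have "rfun 1 (\<lambda>xs. LEAST y. Suc ((y # xs) ! 1) - triangle (Suc ((y # xs) ! 0)) = 0)"
  proof (rule rfun_mu[where f = "\<lambda>xs. Suc (xs ! 1) - triangle (Suc (xs ! 0))"])
    show "\<exists>y. Suc ((y # xs) ! 1) - triangle (Suc ((y # xs) ! 0)) = 0" for xs
      using le[of "xs ! 0"] by (intro exI[of _ "xs ! 0"]) simp
  qed
  then show ?thesis using rfun_comp1 assms by (fastforce simp: diagonal_def)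
qed

lemma pfst_conv_diagonal: "pfst z = z - triangle (diagonal z)"
proof -
  have "diagonal z = pfst z + psnd z" using diagonal_pair[of "pfst z" "psnd z"] by simp
  moreover have "z = triangle (pfst z + psnd z) + pfst z"
    using pair_pfst_psnd[of z, symmetric] unfolding pair_def prod_encode_def by simp
  ultimately show ?thesis by simp
qed

lemma psnd_conv_diagonal: "psnd z = diagonal z - pfst z"
  using diagonal_pair[of "pfst z" "psnd z"] by simp

lemma rfun_pfst: "rfun n a \<Longrightarrow> rfun n (\<lambda>xs. pfst (a xs))"
  unfolding pfst_conv_diagonal by (intro rfun_diff rfun_triangle rfun_diagonal)

lemma rfun_psnd: "rfun n a \<Longrightarrow> rfun n (\<lambda>xs. psnd (a xs))"
  unfolding psnd_conv_diagonal by (intro rfun_diff rfun_diagonal rfun_pfst)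

text \<open>Unary functions suffice from here on, because several arguments travel in one number
  packed by \<open>pair\<close>.\<close>

definition cmp :: "(nat \<Rightarrow> nat) \<Rightarrow> bool" where
  "cmp f \<longleftrightarrow> rfun 1 (\<lambda>xs. f (hd xs))"

lemma rfun_cmp: "cmp f \<Longrightarrow> rfun n a \<Longrightarrow> rfun n (\<lambda>xs. f (a xs))"
  unfolding cmp_def using rfun_comp1[of "\<lambda>xs. f (hd xs)" n a] by simp

lemma cmp_comp: "cmp f \<Longrightarrow> cmp g \<Longrightarrow> cmp (\<lambda>x. f (g x))"
  unfolding cmp_def[of g] cmp_def[of "\<lambda>x. f (g x)"] by (rule rfun_cmp)

named_theorems cmp_intros

lemma [cmp_intros]: "cmp (\<lambda>x. x)" and [cmp_intros]: "cmp (\<lambda>x. c)"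
  by (simp_all add: cmp_def rfun_hd rfun_const)

lemma [cmp_intros]: "cmp f \<Longrightarrow> cmp (\<lambda>x. Suc (f x))"
  and [cmp_intros]: "cmp f \<Longrightarrow> cmp (\<lambda>x. pfst (f x))"
  and [cmp_intros]: "cmp f \<Longrightarrow> cmp (\<lambda>x. psnd (f x))"
  by (simp_all add: cmp_def rfun_Suc rfun_pfst rfun_psnd)

lemma [cmp_intros]: "cmp f \<Longrightarrow> cmp g \<Longrightarrow> cmp (\<lambda>x. f x + g x)"
  and [cmp_intros]: "cmp f \<Longrightarrow> cmp g \<Longrightarrow> cmp (\<lambda>x. f x * g x)"
  and [cmp_intros]: "cmp f \<Longrightarrow> cmp g \<Longrightarrow> cmp (\<lambda>x. f x - g x)"
  and [cmp_intros]: "cmp f \<Longrightarrow> cmp g \<Longrightarrow> cmp (\<lambda>x. pair (f x) (g x))"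
  by (simp_all add: cmp_def rfun_add rfun_mult rfun_diff rfun_pair)

lemma cmp_if_0 [cmp_intros]:
  assumes "cmp f" "cmp g" "cmp h"
  shows "cmp (\<lambda>x. if f x = 0 then g x else h x)"
proof -
  have "(if f x = 0 then g x else h x) = (1 - f x) * g x + (1 - (1 - f x)) * h x" for x
    by simp
  moreover have "cmp (\<lambda>x. (1 - f x) * g x + (1 - (1 - f x)) * h x)"
    by (intro cmp_intros assms)
  ultimately show ?thesis by simp
qed

text \<open>The form in which primitive recursion reaches the stack machine: running it for a given
  number of steps.\<close>

lemma cmp_funpow [cmp_intros]:
  assumes "cmp s" "cmp f" "cmp g"
  shows "cmp (\<lambda>x. (s ^^ f x) (g x))"
proof -
  have "rfun (Suc 1) (\<lambda>xs. rec_nat (tl xs ! 0) (\<lambda>k r. s ((k # r # tl xs) ! 1)) (hd xs))"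
    by (rule rfun_prim_rec) (auto intro!: rfun_cmp[OF assms(1)] rfun_nth simp del: nth_Cons_Suc)
  then have "rfun 2 (\<lambda>xs. rec_nat (tl xs ! 0) (\<lambda>k r. s ((k # r # tl xs) ! 1)) (hd xs))"
    by (simp add: numeral_2_eq_2)
  moreover have "rec_nat y (\<lambda>k r. s r) x = (s ^^ x) y" for x y by (induction x) auto
  ultimately show ?thesis using rfun_comp2[of _ 1 "\<lambda>xs. f (hd xs)" "\<lambda>xs. g (hd xs)"] assms
    by (fastforce simp: cmp_def)
qed

section \<open>Recursively enumerable predicates\<close>

definition RE0 :: "(nat \<Rightarrow> bool) \<Rightarrow> bool" where
  "RE0 P \<longleftrightarrow> (\<exists>f. cmp f \<and> (\<forall>x. P x \<longleftrightarrow> (\<exists>y. f (pair y x) = 0)))"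

lemma RE0I: "cmp f \<Longrightarrow> (\<And>x. P x \<longleftrightarrow> (\<exists>y. f (pair y x) = 0)) \<Longrightarrow> RE0 P"
  unfolding RE0_def by blast

lemma RE0_comp:
  assumes "RE0 P" "cmp g"
  shows "RE0 (\<lambda>x. P (g x))"
proof -
  obtain f where f: "cmp f" "\<forall>x. P x \<longleftrightarrow> (\<exists>y. f (pair y x) = 0)"
    using assms unfolding RE0_def by auto
  show ?thesis
    by (rule RE0I[where f = "\<lambda>z. f (pair (pfst z) (g (psnd z)))"])
      (use f in \<open>auto intro!: cmp_intros cmp_comp[OF f(1)] cmp_comp[OF assms(2)]\<close>)
qed

lemma RE0_eq0: "cmp f \<Longrightarrow> RE0 (\<lambda>x. f x = 0)"
  by (rule RE0I[where f = "\<lambda>z. f (psnd z)"]) (auto intro!: cmp_intros elim: cmp_comp)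

lemma RE0_eq: 
  assumes "cmp f" "cmp g" shows "RE0 (\<lambda>x. f x = g x)"
proof -
  have "RE0 (\<lambda>x. (f x - g x) + (g x - f x) = 0)" by (intro RE0_eq0 cmp_intros assms)
  moreover have "(f x - g x) + (g x - f x) = 0 \<longleftrightarrow> f x = g x" for x by auto
  ultimately show ?thesis by simp
qed

lemma RE0_less: 
  assumes "cmp f" "cmp g" shows "RE0 (\<lambda>x. f x < g x)"
proof -
  have "RE0 (\<lambda>x. Suc (f x) - g x = 0)" by (intro RE0_eq0 cmp_intros assms)
  then show ?thesis by (simp add: Suc_le_eq)
qed

lemma RE0_disj:
  assumes "RE0 P" "RE0 Q"
  shows "RE0 (\<lambda>x. P x \<or> Q x)"
proof -
  obtain f where f: "cmp f" "\<forall>x. P x \<longleftrightarrow> (\<exists>y. f (pair y x) = 0)"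
    using assms unfolding RE0_def by auto
  obtain g where g: "cmp g" "\<forall>x. Q x \<longleftrightarrow> (\<exists>y. g (pair y x) = 0)"
    using assms unfolding RE0_def by auto
  show ?thesis
    by (rule RE0I[where f = "\<lambda>z. f z * g z"]) (use f g in \<open>auto intro!: cmp_intros\<close>)
qed

lemma RE0_conj:
  assumes "RE0 P" "RE0 Q"
  shows "RE0 (\<lambda>x. P x \<and> Q x)"
proof -
  obtain f where f: "cmp f" "\<forall>x. P x \<longleftrightarrow> (\<exists>y. f (pair y x) = 0)"
    using assms unfolding RE0_def by auto
  obtain g where g: "cmp g" "\<forall>x. Q x \<longleftrightarrow> (\<exists>y. g (pair y x) = 0)"
    using assms unfolding RE0_def by auto
  \<comment> \<open>A sum vanishes iff both summands do; one number carries both witnesses.\<close>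
  let ?h = "\<lambda>z. f (pair (pfst (pfst z)) (psnd z)) + g (pair (psnd (pfst z)) (psnd z))"
  show ?thesis
  proof (rule RE0I)
    show "cmp ?h" by (intro cmp_intros cmp_comp[OF f(1)] cmp_comp[OF g(1)])
    show "P x \<and> Q x \<longleftrightarrow> (\<exists>y. ?h (pair y x) = 0)" for x
    proof
      assume "P x \<and> Q x"
      then obtain a b where "f (pair a x) = 0" "g (pair b x) = 0" using f g by auto
      then show "\<exists>y. ?h (pair y x) = 0" by (intro exI[of _ "pair a b"]) simp
    qed (use f g in auto)
  qed
qed

lemma RE0_ex:
  assumes "RE0 P"
  shows "RE0 (\<lambda>x. \<exists>n. P (pair n x))"
proof -
  obtain f where f: "cmp f" "\<forall>x. P x \<longleftrightarrow> (\<exists>y. f (pair y x) = 0)"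
    using assms unfolding RE0_def by auto
  let ?h = "\<lambda>z. f (pair (pfst (pfst z)) (pair (psnd (pfst z)) (psnd z)))"
  show ?thesis
  proof (rule RE0I)
    show "cmp ?h" by (intro cmp_intros cmp_comp[OF f(1)])
    show "(\<exists>n. P (pair n x)) \<longleftrightarrow> (\<exists>y. ?h (pair y x) = 0)" for x
    proof
      assume "\<exists>n. P (pair n x)"
      then obtain n a where "f (pair a (pair n x)) = 0" using f by auto
      then show "\<exists>y. ?h (pair y x) = 0" by (intro exI[of _ "pair a n"]) simp
    qed (use f in auto)
  qed
qed

lemma RE0_ex':
  assumes "RE0 (\<lambda>z. P (pfst z) (psnd z))"
  shows "RE0 (\<lambda>x. \<exists>n. P n x)"
  using RE0_ex[OF assms] by simp

lemma RE0_const: "RE0 (\<lambda>x. b)"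
  using RE0_eq0[of "\<lambda>x. if b then 0 else 1"] by (cases b) (auto intro!: cmp_intros)

subsection \<open>Well-founded rule systems\<close>

text \<open>A stack machine searches for a derivation. Its state \<open>pair S C\<close> consists of a stack \<open>S\<close>
  of lists of goals and a stream \<open>C\<close> of choices, read off by iterated unpairing; a choice
  \<open>pair y Q\<close> for a goal \<open>z\<close> names the premises \<open>Q\<close> and a witness \<open>y\<close> that the rule
  from \<open>Q\<close> to \<open>z\<close> applies.\<close>

abbreviation cons :: "nat \<Rightarrow> nat \<Rightarrow> nat" where "cons a l \<equiv> Suc (pair a l)"

lemma list_decode_cons [simp]: "list_decode (cons a l) = a # list_decode l"
  by (simp add: pair_def)

declare list_decode.simps(2) [simp del]

lemma list_encode_Cons: "list_encode (x # xs) = cons x (list_encode xs)"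
  by (simp add: pair_def)

text \<open>A choice that does not fit the current goal leaves the state unchanged, so a wrong
  stream never empties the stack. The code 0 is both the empty goal list and the empty stack, hence
  the \<open>- 1\<close> before each unpairing.\<close>

definition search_step :: "(nat \<Rightarrow> nat) \<Rightarrow> nat \<Rightarrow> nat" where
  "search_step f n =
     (let S = pfst n; C = psnd n; L = pfst (S - 1); S' = psnd (S - 1);
          z = pfst (L - 1); L' = psnd (L - 1); y = pfst (pfst C); Q = psnd (pfst C)
      in if S = 0 then n
         else if L = 0 then pair S' C
         else if f (pair y (pair z Q)) = 0 then pair (cons Q (cons L' S')) (psnd C)
         else n)"

lemma cmp_search_step:
  assumes "cmp f"
  shows "cmp (search_step f)"
  unfolding search_step_def Let_def by (intro cmp_intros cmp_comp[OF assms])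

lemma list_decode_cases: "m = 0 \<or> m = cons (pfst (m - 1)) (psnd (m - 1))"
  by (cases m) simp_all

text \<open>The searched-for number is a run length together with a stream of choices. Soundness
  needs no measure, because an invariant is followed backwards from the empty stack; the measure
  drives the induction that builds a successful stream.\<close>

lemma RE0_rules:
  fixes m :: "nat \<Rightarrow> nat"
  assumes R: "RE0 (\<lambda>z. R (pfst z) (list_decode (psnd z)))"
    and sound: "\<And>z ps. R z ps \<Longrightarrow> (\<And>p. p \<in> set ps \<Longrightarrow> P p) \<Longrightarrow> P z"
    and complete: "\<And>z. P z \<Longrightarrow> \<exists>ps. R z ps \<and> (\<forall>p \<in> set ps. P p \<and> m p < m z)"
  shows "RE0 P"
proof -
  obtain f where f: "cmp f"
    and Rf: "\<And>z. R (pfst z) (list_decode (psnd z)) \<longleftrightarrow> (\<exists>y. f (pair y z) = 0)"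
    using R unfolding RE0_def by auto
  let ?s = "search_step f"
  \<comment> \<open>\<open>Ok\<close> is trivial for the empty stack, and each step preserves it in
    the backward direction: if the premises pushed are true, so is the goal that they
    replaced.\<close>
  define Ok where "Ok S \<longleftrightarrow> (\<forall>L \<in> set (list_decode S). \<forall>z \<in> set (list_decode L). P z)" for S
  have Ok_step: "Ok (pfst n)" if "Ok (pfst (?s n))" for n
  proof (cases "?s n = n")
    case False
    define S C where "S = pfst n" and "C = psnd n"
    define L S' where "L = pfst (S - 1)" and "S' = psnd (S - 1)"
    define z L' where "z = pfst (L - 1)" and "L' = psnd (L - 1)"
    define y Q where "y = pfst (pfst C)" and "Q = psnd (pfst C)"
    note defs = S_def C_def L_def S'_def z_def L'_def y_def Q_def
    have n: "n = pair S C" by (simp add: defs)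
    have S: "S = cons L S'"
      using False list_decode_cases[of S] by (auto simp: search_step_def defs)
    show ?thesis
    proof (cases "L = 0")
      case True
      then have "?s n = pair S' C" using S by (simp add: search_step_def n)
      then show ?thesis using that S True by (simp add: n Ok_def)
    next
      case nz: False
      then have L: "L = cons z L'" using list_decode_cases[of L] by (auto simp: z_def L'_def)
      have fz: "f (pair y (pair z Q)) = 0"
        and "?s n = pair (cons Q (cons L' S')) (psnd C)"
        using False S L by (auto simp: search_step_def n y_def Q_def Let_def split: if_splits)
      then have Ok: "Ok (cons Q (cons L' S'))" using that by simp
      moreover have "R z (list_decode Q)" using Rf[of "pair z Q"] fz by auto
      ultimately have "P z" using sound by (auto simp: Ok_def)
      then show ?thesis using Ok by (auto simp: n S L Ok_def)
    qed
  qed (use that in simp)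
  have Ok_steps: "Ok (pfst n)" if "pfst ((?s ^^ k) n) = 0" for k n
    using that
  proof (induction k arbitrary: n)
    case (Suc k)
    then have "Ok (pfst (?s n))" by (simp add: funpow_swap1)
    then show ?case by (rule Ok_step)
  qed (simp add: Ok_def)
  \<comment> \<open>The stream is built in front of a prescribed remainder \<open>C'\<close>, so
    that the runs for successive goals can be chained, the last one being chosen first.\<close>
  have run: "\<exists>k C. (?s ^^ k) (pair (cons (cons z L) S) C) = pair (cons L S) C'" if "P z" for z L S C'
    using that
  proof (induction "m z" arbitrary: z L S C' rule: less_induct)
    case less
    obtain ps where ps: "R z ps" "\<And>p. p \<in> set ps \<Longrightarrow> P p \<and> m p < m z"
      using complete less.prems by blast
    have "\<exists>k C. (?s ^^ k) (pair (cons (list_encode qs) (cons L S)) C) = pair (cons L S) C'"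
      if "set qs \<subseteq> set ps" for qs
      using that
    proof (induction qs)
      case Nil
      have "(?s ^^ 1) (pair (cons (list_encode []) (cons L S)) C') = pair (cons L S) C'"
        by (simp add: search_step_def)
      then show ?case by blast
    next
      case (Cons q qs)
      then obtain k C where k: "(?s ^^ k) (pair (cons (list_encode qs) (cons L S)) C) = pair (cons L S) C'"
        by auto
      moreover have "P q" "m q < m z" using ps Cons.prems by auto
      then obtain k2 C2 where "(?s ^^ k2) (pair (cons (cons q (list_encode qs)) (cons L S)) C2)
          = pair (cons (list_encode qs) (cons L S)) C"
        using less.hyps by blast
      ultimately have "(?s ^^ (k + k2)) (pair (cons (cons q (list_encode qs)) (cons L S)) C2) = pair (cons L S) C'"
        by (simp add: funpow_add)
      then show ?case unfolding list_encode_Cons by blast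
    qed
    then obtain k C where k: "(?s ^^ k) (pair (cons (list_encode ps) (cons L S)) C) = pair (cons L S) C'"
      by blast
    obtain y where y: "f (pair y (pair z (list_encode ps))) = 0"
      using Rf[of "pair z (list_encode ps)"] ps(1) by auto
    have "?s (pair (cons (cons z L) S) (pair (pair y (list_encode ps)) C)) = pair (cons (list_encode ps) (cons L S)) C"
      by (simp add: search_step_def y)
    then have "(?s ^^ Suc k) (pair (cons (cons z L) S) (pair (pair y (list_encode ps)) C)) = pair (cons L S) C'"
      using k by (simp add: funpow_swap1)
    then show ?case by blast
  qed
  let ?g = "\<lambda>w. pfst ((?s ^^ (pfst (pfst w))) (pair (cons (cons (psnd w) 0) 0) (psnd (pfst w))))"
  show ?thesis
  proof (rule RE0I)
    show "cmp ?g" by (intro cmp_intros cmp_search_step f)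
    show "P x \<longleftrightarrow> (\<exists>y. ?g (pair y x) = 0)" for x
    proof
      assume "P x"
      then obtain k C where k: "(?s ^^ k) (pair (cons (cons x 0) 0) C) = pair (cons 0 0) 0"
        using run by blast
      \<comment> \<open>The only goal list is exhausted now; one more step pops it.\<close>
      then have "(?s ^^ Suc k) (pair (cons (cons x 0) 0) C) = pair 0 0"
        by (simp add: search_step_def)
      then show "\<exists>y. ?g (pair y x) = 0" by (intro exI[of _ "pair (Suc k) C"]) (simp del: funpow.simps)
    next
      assume "\<exists>y. ?g (pair y x) = 0"
      then obtain k C where "pfst ((?s ^^ k) (pair (cons (cons x 0) 0) C)) = 0" by auto
      from Ok_steps[OF this] show "P x" by (simp add: Ok_def)
    qed
  qed
qed

subsection \<open>Encodable types\<close>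

text \<open>Besides injectivity the codes must be enumerable: otherwise even the always true
  predicate would not be recursively enumerable on codes.\<close>

class enc =
  fixes enc :: "'a \<Rightarrow> nat"
  assumes enc_inject [simp]: "enc x = enc y \<longleftrightarrow> x = y"
    and RE0_range_enc: "RE0 (\<lambda>n. n \<in> range enc)"

instantiation nat :: enc
begin
definition "enc (n :: nat) = n"
instance by standard (simp_all add: enc_nat_def RE0_const)
end

instantiation bool :: enc
begin
definition "enc b = (if b then 1 else 0 :: nat)"
instance
proof
  have "range (enc :: bool \<Rightarrow> nat) = {0, 1}" by (auto simp: enc_bool_def image_iff UNIV_bool)
  then show "RE0 (\<lambda>n. n \<in> range (enc :: bool \<Rightarrow> nat))"
    by (auto intro!: RE0_disj RE0_eq cmp_intros)
qed (simp add: enc_bool_def)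
end

instantiation prod :: (enc, enc) enc
begin
definition "enc z = pair (enc (fst z)) (enc (snd z))"
instance
proof
  have "n \<in> range (enc :: 'a \<times> 'b \<Rightarrow> nat)"
    if "pfst n = enc a" "psnd n = enc b" for n and a :: 'a and b :: 'b
    using that pair_pfst_psnd[of n] by (intro image_eqI[of _ _ "(a, b)"]) (auto simp: enc_prod_def)
  then have "n \<in> range (enc :: 'a \<times> 'b \<Rightarrow> nat) \<longleftrightarrow>
      pfst n \<in> range (enc :: 'a \<Rightarrow> nat) \<and> psnd n \<in> range (enc :: 'b \<Rightarrow> nat)" for n
    by (auto simp: enc_prod_def)
  then show "RE0 (\<lambda>n. n \<in> range (enc :: 'a \<times> 'b \<Rightarrow> nat))"
    by (simp only:) (intro RE0_conj RE0_comp[OF RE0_range_enc] cmp_intros)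
qed (auto simp: enc_prod_def prod_eq_iff pair_eq_iff)
end

instantiation list :: (enc) enc
begin
definition "enc xs = list_encode (map enc xs)"
instance
proof
  show "enc xs = enc ys \<longleftrightarrow> xs = ys" for xs ys :: "'a list"
    by (auto simp: enc_list_def inj_map_eq_map inj_def list_encode_eq)
  have range: "n \<in> range (enc :: 'a list \<Rightarrow> nat) \<longleftrightarrow> set (list_decode n) \<subseteq> range (enc :: 'a \<Rightarrow> nat)" for n
  proof
    assume "set (list_decode n) \<subseteq> range (enc :: 'a \<Rightarrow> nat)"
    then obtain xs :: "'a list" where "list_decode n = map enc xs"
      by (metis ex_map_conv subsetD rangeE)
    then have "enc xs = n" by (metis enc_list_def list_decode_inverse)
    then show "n \<in> range (enc :: 'a list \<Rightarrow> nat)" by auto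
  qed (auto simp: enc_list_def)
  show "RE0 (\<lambda>n. n \<in> range (enc :: 'a list \<Rightarrow> nat))"
    unfolding range
  proof (rule RE0_rules[where m = "\<lambda>n. length (list_decode n)" and R = "\<lambda>n ps. n = 0 \<and> ps = [] \<or>
      (\<exists>l x. n = cons x l \<and> x \<in> range (enc :: 'a \<Rightarrow> nat) \<and> ps = [l])"])
    \<comment> \<open>Encoding a list of known length is iterated \<open>cons\<close>, hence
      computable; this orientation avoids having to compute \<open>list_decode\<close>.\<close>
    have *: "list_decode n = ps \<longleftrightarrow> n = list_encode ps" for n ps by auto
    show "RE0 (\<lambda>z. pfst z = 0 \<and> list_decode (psnd z) = [] \<or>
      (\<exists>l x. pfst z = cons x l \<and> x \<in> range (enc :: 'a \<Rightarrow> nat) \<and> list_decode (psnd z) = [l]))"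
      unfolding * list_encode_Cons list_encode.simps(1)
      by (rule RE0_disj RE0_conj RE0_ex' RE0_eq RE0_comp[OF RE0_range_enc] cmp_intros)+
  next
    fix n assume *: "set (list_decode n) \<subseteq> range (enc :: 'a \<Rightarrow> nat)"
    show "\<exists>ps. (n = 0 \<and> ps = [] \<or> (\<exists>l x. n = cons x l \<and> x \<in> range (enc :: 'a \<Rightarrow> nat) \<and> ps = [l])) \<and>
      (\<forall>p\<in>set ps. set (list_decode p) \<subseteq> range (enc :: 'a \<Rightarrow> nat) \<and> length (list_decode p) < length (list_decode n))"
    proof (cases "n = 0")
      case False
      then obtain x l where n: "n = cons x l" using list_decode_cases[of n] by blast
      from * show ?thesis unfolding n by (intro exI[of _ "[l]"]) auto
    qed simp
  qed auto
qed
end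

section \<open>Recursively enumerable predicates and computable functions on encodable types\<close>

definition RE :: "('a :: enc \<Rightarrow> bool) \<Rightarrow> bool" where
  "RE P \<longleftrightarrow> RE0 (\<lambda>n. \<exists>x. n = enc x \<and> P x)"

text \<open>A total function is handled through its graph: a value is found by searching, so a
  recursive definition never has to be compiled into \<open>recursive_fun\<close>.\<close>

definition computable :: "('a :: enc \<Rightarrow> 'b :: enc) \<Rightarrow> bool" where
  "computable f \<longleftrightarrow> RE (\<lambda>z. snd z = f (fst z))"

named_theorems re

lemma computableI: "RE (\<lambda>z. snd z = f (fst z)) \<Longrightarrow> computable f"
  by (simp add: computable_def)

lemma RE_cong: "RE P \<Longrightarrow> (\<And>x. Q x \<longleftrightarrow> P x) \<Longrightarrow> RE Q"
  by (simp add: RE_def)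

lemma RE_const [re]: "RE (\<lambda>x :: 'a :: enc. b)"
proof -
  have "RE0 (\<lambda>n. n \<in> range (enc :: 'a \<Rightarrow> nat) \<and> b)"
    by (intro RE0_conj RE0_range_enc RE0_const)
  then show ?thesis by (simp add: RE_def image_iff)
qed

lemma RE_conj [re]:
  assumes "RE P" "RE Q"
  shows "RE (\<lambda>x. P x \<and> Q x)"
proof -
  have "(\<exists>x. n = enc x \<and> P x \<and> Q x) \<longleftrightarrow> (\<exists>x. n = enc x \<and> P x) \<and> (\<exists>x. n = enc x \<and> Q x)" for n
    by auto
  then show ?thesis using RE0_conj assms by (simp add: RE_def)
qed

lemma RE_disj [re]:
  assumes "RE P" "RE Q"
  shows "RE (\<lambda>x. P x \<or> Q x)"
proof -
  have "(\<exists>x. n = enc x \<and> (P x \<or> Q x)) \<longleftrightarrow> (\<exists>x. n = enc x \<and> P x) \<or> (\<exists>x. n = enc x \<and> Q x)" for n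
    by auto
  then show ?thesis using RE0_disj assms by (simp add: RE_def)
qed

lemma enc_Pair: "enc (a, b) = pair (enc a) (enc b)"
  by (simp add: enc_prod_def)

lemma eq_pair_iff: "n = pair a b \<longleftrightarrow> pfst n = a \<and> psnd n = b"
  by auto

lemmas ex_enc_prod = enc_Pair eq_pair_iff

lemma RE_ex [re]:
  assumes "RE (\<lambda>z. P (fst z) (snd z))"
  shows "RE (\<lambda>x. \<exists>y. P x y)"
proof -
  have "RE0 (\<lambda>n. \<exists>x y. pfst n = enc x \<and> psnd n = enc y \<and> P x y)"
    using assms by (simp add: RE_def ex_enc_prod conj_assoc)
  \<comment> \<open>\<open>RE0_ex'\<close> expects the bound variable in front, so the components
    change places.\<close>
  then have "RE0 (\<lambda>k. \<exists>x y. pfst (pair (psnd k) (pfst k)) = enc x \<and> psnd (pair (psnd k) (pfst k)) = enc y \<and> P x y)"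
    by (rule RE0_comp) (intro cmp_intros)
  then have "RE0 (\<lambda>n. \<exists>m x y. n = enc x \<and> m = enc y \<and> P x y)"
    by (intro RE0_ex') simp
  then show ?thesis unfolding RE_def by (rule back_subst[of RE0]) auto
qed

text \<open>Bootstraps substitution: rearranging a tuple acts on codes by projections and pairing,
  so it can be substituted before \<open>computable\<close> is known to be closed under
  composition.\<close>

lemma RE_code_comp:
  assumes "RE P" "cmp g" "\<And>x. enc (h x) = g (enc x)"
  shows "RE (\<lambda>x :: 'a :: enc. P (h x))"
proof -
  have "RE0 (\<lambda>n. n \<in> range (enc :: 'a \<Rightarrow> nat) \<and> (\<exists>y. g n = enc y \<and> P y))"
    using assms(1) unfolding RE_def
    by (intro RE0_conj RE0_range_enc RE0_comp[where P = "\<lambda>n. \<exists>y. n = enc y \<and> P y", OF _ assms(2)])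
  moreover have "(\<exists>x. n = enc x \<and> P (h x)) \<longleftrightarrow>
      n \<in> range (enc :: 'a \<Rightarrow> nat) \<and> (\<exists>y. g n = enc y \<and> P y)" for n
    using assms(3) by (metis enc_inject image_iff rangeI)
  ultimately show ?thesis by (simp add: RE_def)
qed

lemma RE_snd: "RE P \<Longrightarrow> RE (\<lambda>z. P (snd z))"
  by (rule RE_code_comp[where g = psnd]) (auto simp: enc_prod_def intro!: cmp_intros)

lemma RE_comp:
  assumes "RE P" "computable f"
  shows "RE (\<lambda>x. P (f x))"
proof -
  have "RE (\<lambda>x. \<exists>y. y = f x \<and> P y)"
    using assms by (intro RE_ex RE_conj RE_snd) (simp add: computable_def)
  then show ?thesis by simp
qed

lemma computable_code:
  assumes "cmp g" and "\<And>x. enc (f x) = g (enc x)"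
  shows "computable (f :: 'a :: enc \<Rightarrow> 'b :: enc)"
proof -
  have "RE0 (\<lambda>n. pfst n \<in> range (enc :: 'a \<Rightarrow> nat) \<and> psnd n \<in> range (enc :: 'b \<Rightarrow> nat) \<and> psnd n = g (pfst n))"
    by (intro RE0_conj RE0_comp[OF RE0_range_enc] RE0_eq cmp_intros cmp_comp[OF assms(1)])
  moreover have "(\<exists>z :: 'a \<times> 'b. n = enc z \<and> snd z = f (fst z)) \<longleftrightarrow>
      pfst n \<in> range (enc :: 'a \<Rightarrow> nat) \<and> psnd n \<in> range (enc :: 'b \<Rightarrow> nat) \<and> psnd n = g (pfst n)" for n
    by (auto simp: ex_enc_prod assms(2)) (metis assms(2) rangeI)
  ultimately show ?thesis by (simp add: computable_def RE_def)
qed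

lemma computable_id [re]: "computable (\<lambda>x. x)"
  by (rule computable_code[where g = "\<lambda>x. x"]) (auto intro!: cmp_intros)

lemma computable_const [re]: "computable (\<lambda>x. c)"
  by (rule computable_code[where g = "\<lambda>x. enc c"]) (auto intro!: cmp_intros)

lemma computable_comp:
  assumes "computable f" "computable g"
  shows "computable (\<lambda>x. f (g x))"
proof -
  have "RE (\<lambda>z. snd (fst (fst z), snd z) = g (fst (fst (fst z), snd z)))"
    by (rule RE_code_comp[where h = "\<lambda>z. (fst (fst z), snd z)" and g = "\<lambda>n. pair (pfst (pfst n)) (psnd n)"])
      (use assms(2) in \<open>auto simp: computable_def enc_prod_def intro!: cmp_intros\<close>)
  moreover have "RE (\<lambda>z. snd (snd z, snd (fst z)) = f (fst (snd z, snd (fst z))))"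
    by (rule RE_code_comp[where h = "\<lambda>z. (snd z, snd (fst z))" and g = "\<lambda>n. pair (psnd n) (psnd (pfst n))"])
      (use assms(1) in \<open>auto simp: computable_def enc_prod_def intro!: cmp_intros\<close>)
  ultimately have "RE (\<lambda>z. \<exists>w. w = g (fst z) \<and> snd z = f w)"
    by (intro RE_ex RE_conj) simp_all
  then show ?thesis by (simp add: computable_def)
qed

lemma computable_fst [re]: "computable f \<Longrightarrow> computable (\<lambda>x. fst (f x))"
  by (rule computable_comp, rule computable_code[where g = pfst])
    (auto simp: enc_prod_def intro!: cmp_intros)

lemma computable_snd [re]: "computable f \<Longrightarrow> computable (\<lambda>x. snd (f x))"
  by (rule computable_comp, rule computable_code[where g = psnd])
    (auto simp: enc_prod_def intro!: cmp_intros)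

lemma RE_eq_iff: "RE (\<lambda>z :: 'a :: enc \<times> 'a. fst z = snd z)"
  using computable_code[of "\<lambda>x. x" "\<lambda>x :: 'a. x"] by (simp add: computable_def eq_commute cmp_intros)

lemma computable_Pair [re]:
  assumes "computable f" "computable g"
  shows "computable (\<lambda>x. (f x, g x))"
proof -
  have "RE (\<lambda>z. (\<lambda>p. snd p = f (fst p)) (fst z, fst (snd z)))"
    by (rule RE_code_comp[where g = "\<lambda>n. pair (pfst n) (pfst (psnd n))"])
      (use assms(1) in \<open>auto simp: computable_def enc_prod_def intro!: cmp_intros\<close>)
  moreover have "RE (\<lambda>z. (\<lambda>p. snd p = g (fst p)) (fst z, snd (snd z)))"
    by (rule RE_code_comp[where g = "\<lambda>n. pair (pfst n) (psnd (psnd n))"])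
      (use assms(2) in \<open>auto simp: computable_def enc_prod_def intro!: cmp_intros\<close>)
  ultimately have "RE (\<lambda>z. fst (snd z) = f (fst z) \<and> snd (snd z) = g (fst z))"
    by (intro RE_conj) simp_all
  then show ?thesis by (simp add: computable_def prod_eq_iff)
qed

lemma RE_comp2:
  "RE (\<lambda>z. P (fst z) (snd z)) \<Longrightarrow> computable f \<Longrightarrow> computable g \<Longrightarrow> RE (\<lambda>x. P (f x) (g x))"
  using RE_comp[of "\<lambda>z. P (fst z) (snd z)" "\<lambda>x. (f x, g x)"] by (simp add: computable_Pair)

lemma computable_comp2:
  "computable (\<lambda>z. h (fst z) (snd z)) \<Longrightarrow> computable f \<Longrightarrow> computable g \<Longrightarrow> computable (\<lambda>x. h (f x) (g x))"
  using computable_comp[of "\<lambda>z. h (fst z) (snd z)" "\<lambda>x. (f x, g x)"] by (simp add: computable_Pair)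

lemma RE_eq [re]: "computable f \<Longrightarrow> computable g \<Longrightarrow> RE (\<lambda>x. f x = g x)"
  by (rule RE_comp2[OF RE_eq_iff])

text \<open>Codes are numbers, so distinct ones are ordered one way or the other. This serves the
  rule of \<open>lookup\<close> that skips a binding.\<close>

lemma RE_neq [re]:
  assumes "computable f" "computable g" shows "RE (\<lambda>x. f x \<noteq> (g x :: 'a :: enc))"
proof (rule RE_comp2[OF _ assms])
  have "RE0 (\<lambda>n. n \<in> range (enc :: 'a \<times> 'a \<Rightarrow> nat) \<and> (pfst n < psnd n \<or> psnd n < pfst n))"
    by (intro RE0_conj RE0_disj RE0_less RE0_range_enc cmp_intros)
  moreover have "(\<exists>z. n = enc z \<and> fst z \<noteq> (snd z :: 'a)) \<longleftrightarrow>
      n \<in> range (enc :: 'a \<times> 'a \<Rightarrow> nat) \<and> (pfst n < psnd n \<or> psnd n < pfst n)" for n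
    by (auto simp: ex_enc_prod image_iff neq_iff[symmetric])
  ultimately show "RE (\<lambda>z. fst z \<noteq> (snd z :: 'a))" by (simp add: RE_def)
qed

lemma computable_Suc [re]: "computable f \<Longrightarrow> computable (\<lambda>x. Suc (f x))"
  by (rule computable_comp, rule computable_code[where g = Suc]) (auto simp: enc_nat_def intro!: cmp_intros)

lemma computable_add [re]: "computable f \<Longrightarrow> computable g \<Longrightarrow> computable (\<lambda>x. f x + g x :: nat)"
  by (rule computable_comp2, rule computable_code[where g = "\<lambda>n. pfst n + psnd n"])
    (auto simp: enc_nat_def enc_prod_def intro!: cmp_intros)

lemma computable_mult [re]: "computable f \<Longrightarrow> computable g \<Longrightarrow> computable (\<lambda>x. f x * g x :: nat)"
  by (rule computable_comp2, rule computable_code[where g = "\<lambda>n. pfst n * psnd n"])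
    (auto simp: enc_nat_def enc_prod_def intro!: cmp_intros)

lemma RE_less [re]:
  assumes "computable f" "computable g" shows "RE (\<lambda>x. f x < (g x :: nat))"
proof -
  have "RE (\<lambda>x. \<exists>k. g x = Suc (f x + k))"
    by (intro re computable_comp[OF assms(1)] computable_comp[OF assms(2)])
  then show ?thesis by (simp add: less_iff_Suc_add)
qed

text \<open>On codes, a list cell is the successor of the pair of its parts.\<close>

lemma computable_Cons [re]: "computable f \<Longrightarrow> computable g \<Longrightarrow> computable (\<lambda>x. f x # g x)"
  by (rule computable_comp2, rule computable_code[where g = "\<lambda>n. Suc n"])
    (auto simp: enc_list_def enc_prod_def pair_def intro!: cmp_intros)

text \<open>Soundness puts every derivable instance into P; completeness and the measure make every
  instance of P derivable. Since R is an ordinary formula, its enumerability follows from the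
  \<open>re\<close> rules, and each use only has to supply rules and a measure.\<close>

theorem RE_rules:
  fixes m :: "'a :: enc \<Rightarrow> nat"
  assumes R: "RE (\<lambda>z. R (fst z) (snd z))"
    and sound: "\<And>z ps. R z ps \<Longrightarrow> \<forall>p \<in> set ps. P p \<Longrightarrow> P z"
    and complete: "\<And>z. P z \<Longrightarrow> \<exists>ps. R z ps \<and> (\<forall>p \<in> set ps. P p \<and> m p < m z)"
  shows "RE P"
  unfolding RE_def
proof (rule RE0_rules[where m = "\<lambda>n. m (inv enc n)"
      and R = "\<lambda>n l. \<exists>z ps. n = enc z \<and> list_encode l = enc ps \<and> R z ps"])
  have inv [simp]: "inv enc (enc x) = x" for x :: 'a by (simp add: inj_def inv_f_f)
  show "RE0 (\<lambda>z. \<exists>x ps. pfst z = enc x \<and> list_encode (list_decode (psnd z)) = enc ps \<and> R x ps)"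
    using R by (simp add: RE_def ex_enc_prod)
  show "\<exists>x. n = enc x \<and> P x"
    if rule: "\<exists>z ps. n = enc z \<and> list_encode l = enc ps \<and> R z ps"
      and IH: "\<And>p. p \<in> set l \<Longrightarrow> \<exists>x. p = enc x \<and> P x" for n l
  proof -
    obtain z ps where z: "n = enc z" "list_encode l = enc ps" "R z ps" using rule by blast
    then have "l = map enc ps" by (simp add: enc_list_def list_encode_eq)
    then have "P p" if "p \<in> set ps" for p using IH[of "enc p"] that by auto
    then show ?thesis using z sound by auto
  qed
  show "\<exists>l. (\<exists>z ps. n = enc z \<and> list_encode l = enc ps \<and> R z ps) \<and>
      (\<forall>p \<in> set l. (\<exists>x. p = enc x \<and> P x) \<and> m (inv enc p) < m (inv enc n))"
    if ex: "\<exists>x. n = enc x \<and> P x" for n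
  proof -
    obtain x where x: "n = enc x" "P x" using ex by blast
    from complete[OF x(2)] obtain ps where "R x ps" "\<forall>p \<in> set ps. P p \<and> m p < m x" by blast
    then show ?thesis by (intro exI[of _ "map enc ps"]) (auto simp: x enc_list_def)
  qed
qed

lemma computable_graph1:
  assumes "RE (\<lambda>(x, y). y = h x)" "computable f"
  shows "computable (\<lambda>x. h (f x))"
  by (rule computable_comp[OF computableI assms(2)]) (use assms(1) in \<open>simp add: case_prod_beta'\<close>)

lemma computable_graph2:
  assumes "RE (\<lambda>(x, y, z). z = h x y)" "computable f" "computable g"
  shows "computable (\<lambda>x. h (f x) (g x))"
proof -
  have "RE (\<lambda>z. (\<lambda>(x, y, z). z = h x y) (fst (fst z), snd (fst z), snd z))"
    by (intro RE_comp[OF assms(1)] re)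
  then have "computable (\<lambda>z. h (fst z) (snd z))" by (simp add: computable_def)
  then show ?thesis by (rule computable_comp2) (use assms in auto)
qed

subsection \<open>Functions on lists\<close>

lemma computable_append [re]:
  assumes "computable f" "computable g"
  shows "computable (\<lambda>x. f x @ g x)"
proof (rule computable_graph2[OF _ assms])
  show "RE (\<lambda>(xs, ys, zs :: 'b list). zs = xs @ ys)"
  proof (rule RE_rules[where m = "\<lambda>z. length (fst z)"
        and R = "\<lambda>z ps. (\<exists>ys. z = ([], ys, ys) \<and> ps = []) \<or>
          (\<exists>x xs ys zs. z = (x # xs, ys, x # zs) \<and> ps = [(xs, ys, zs)])"])
    fix z :: "'b list \<times> 'b list \<times> 'b list"
    assume "case z of (xs, ys, zs) \<Rightarrow> zs = xs @ ys"
    then obtain xs ys where "z = (xs, ys, xs @ ys)" by (cases z) auto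
    then show "\<exists>ps. ((\<exists>ys. z = ([], ys, ys) \<and> ps = []) \<or>
          (\<exists>x xs ys zs. z = (x # xs, ys, x # zs) \<and> ps = [(xs, ys, zs)])) \<and>
        (\<forall>p \<in> set ps. (case p of (xs, ys, zs) \<Rightarrow> zs = xs @ ys) \<and> length (fst p) < length (fst z))"
      by (cases xs) auto
  qed (auto intro!: re)
qed

lemma computable_map [re]:
  assumes "computable h" "computable f"
  shows "computable (\<lambda>x. map h (f x))"
proof (rule computable_graph1[OF _ assms(2)])
  show "RE (\<lambda>(xs, ys). ys = map h xs)"
  proof (rule RE_rules[where m = "\<lambda>z. length (fst z)"
        and R = "\<lambda>z ps. (z = ([], []) \<and> ps = []) \<or>
          (\<exists>x xs ys. z = (x # xs, h x # ys) \<and> ps = [(xs, ys)])"])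
    fix z assume "case z of (xs, ys) \<Rightarrow> ys = map h xs"
    then obtain xs where "z = (xs, map h xs)" by (cases z) auto
    then show "\<exists>ps. ((z = ([], []) \<and> ps = []) \<or>
          (\<exists>x xs ys. z = (x # xs, h x # ys) \<and> ps = [(xs, ys)])) \<and>
        (\<forall>p \<in> set ps. (case p of (xs, ys) \<Rightarrow> ys = map h xs) \<and> length (fst p) < length (fst z))"
      by (cases xs) auto
  qed (auto intro!: re computable_comp[OF assms(1)])
qed

lemma RE_member [re]:
  "computable f \<Longrightarrow> computable g \<Longrightarrow> RE (\<lambda>x. f x \<in> set (g x))"
proof -
  assume *: "computable f" "computable g"
  have "RE (\<lambda>x. \<exists>ys zs. g x = ys @ f x # zs)"
    by (intro re computable_comp[OF *(1)] computable_comp[OF *(2)])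
  then show ?thesis by (simp add: in_set_conv_decomp)
qed

subsection \<open>Terms and formulas\<close>

lemma idx_code_0: "idx_code 0 = [False]"
  by (simp add: idx_code_def bin_digits.simps)

lemma idx_code_pos: "0 < n \<Longrightarrow> idx_code n = True # odd n # idx_code (n div 2)"
  by (simp add: idx_code_def bin_digits.simps[of n])

text \<open>Halving is replaced by guessing: a positive number is 2k + 1 or 2k + 2, with half k or k
  + 1.\<close>

lemma computable_idx_code [re]:
  assumes "computable f"
  shows "computable (\<lambda>x. idx_code (f x))"
proof (rule computable_graph1[OF _ assms])
  show "RE (\<lambda>(n, w). w = idx_code n)"
  proof (rule RE_rules[where m = fst
        and R = "\<lambda>z ps. z = (0, [False]) \<and> ps = [] \<or>
          (\<exists>k w. z = (Suc (k + k), True # True # w) \<and> ps = [(k, w)]) \<or>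
          (\<exists>k w. z = (Suc (Suc (k + k)), True # False # w) \<and> ps = [(Suc k, w)])"])
    fix z assume "case z of (n, w) \<Rightarrow> w = idx_code n"
    then obtain n where z: "z = (n, idx_code n)" by (cases z) auto
    consider "n = 0" | k where "n = Suc (k + k)" | k where "n = Suc (Suc (k + k))"
      by (metis mult_2 not0_implies_Suc oddE evenE Suc_eq_plus1 even_Suc)
    then show "\<exists>ps. (z = (0, [False]) \<and> ps = [] \<or>
          (\<exists>k w. z = (Suc (k + k), True # True # w) \<and> ps = [(k, w)]) \<or>
          (\<exists>k w. z = (Suc (Suc (k + k)), True # False # w) \<and> ps = [(Suc k, w)])) \<and>
        (\<forall>p \<in> set ps. (case p of (n, w) \<Rightarrow> w = idx_code n) \<and> fst p < fst z)"
    proof cases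
      case 2
      then have "idx_code n = True # True # idx_code k" by (simp add: idx_code_pos)
      with 2 z show ?thesis by (intro exI[of _ "[(k, idx_code k)]"]) auto
    next
      case 3
      then have "idx_code n = True # False # idx_code (Suc k)" by (simp add: idx_code_pos)
      with 3 z show ?thesis by (intro exI[of _ "[(Suc k, idx_code (Suc k))]"]) auto
    qed (auto simp: z idx_code_0)
  next
    fix z ps
    assume "z = (0, [False]) \<and> ps = [] \<or>
          (\<exists>k w. z = (Suc (k + k), True # True # w) \<and> ps = [(k, w)]) \<or>
          (\<exists>k w. z = (Suc (Suc (k + k)), True # False # w) \<and> ps = [(Suc k, w)])"
      and "\<forall>p \<in> set ps. case p of (n, w) \<Rightarrow> w = idx_code n"
    then show "case z of (n, w) \<Rightarrow> w = idx_code n"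
      by (auto simp: idx_code_0 idx_code_pos)
  qed (intro re)
qed

text \<open>The rules are the grammar of the prefix code. They speak of words because terms become
  encodable only through this lemma.\<close>

lemma RE_range_tm_code: "RE (\<lambda>w. w \<in> range tm_code)"
proof (rule RE_rules[where m = length and R = "\<lambda>w ps.
    (\<exists>i. w = [False, False, False] @ idx_code i \<and> ps = []) \<or>
    w = [False, False, True] \<and> ps = [] \<or>
    w = [False, True, False] \<and> ps = [] \<or>
    (\<exists>u v. w = [False, True, True] @ u @ v \<and> ps = [u, v]) \<or>
    (\<exists>u v. w = [True, False, False] @ u @ v \<and> ps = [u, v]) \<or>
    (\<exists>u. w = [True, False, True] @ u \<and> ps = [u])"], goal_cases)
  case 1
  show ?case by (intro re)
next
  case (2 w ps)
  have "[False, True, True] @ u @ v \<in> range tm_code" "[True, False, False] @ u @ v \<in> range tm_code"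
    "[True, False, True] @ u \<in> range tm_code"
    if "u \<in> range tm_code" "v \<in> range tm_code" for u v
    using that by (elim rangeE; simp only: tm_code.simps(3-)[symmetric] rangeI)+
  moreover have "[False, False, False] @ idx_code i \<in> range tm_code" "[False, False, True] \<in> range tm_code"
    "[False, True, False] \<in> range tm_code" for i
    by (simp_all only: tm_code.simps[symmetric] rangeI)
  ultimately show ?case using 2 by (elim disjE exE conjE) simp_all
next
  case (3 w)
  then obtain t where w: "w = tm_code t" by auto
  show ?case
  proof (cases t)
    case (Add s u)
    with w show ?thesis by (intro exI[of _ "[tm_code s, tm_code u]"]) auto
  next
    case (Mul s u)
    with w show ?thesis by (intro exI[of _ "[tm_code s, tm_code u]"]) auto
  qed (use w in auto)
qed


lemma inj_tm_code: "tm_code s = tm_code t \<longleftrightarrow> s = t"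
  using tm_code_prefix_free[of s "[]" t "[]"] by auto

lemma fm_code_eq_iff: "fm_code p = fm_code q \<longleftrightarrow> p = q"
  using inj_fm_code by (auto simp: inj_def)

lemma RE0_range_code:
  assumes "RE (\<lambda>w. w \<in> range c)"
  shows "RE0 (\<lambda>n. n \<in> range (\<lambda>x. enc (c x)))"
proof -
  have "n \<in> range (\<lambda>x. enc (c x)) \<longleftrightarrow> (\<exists>w. n = enc w \<and> w \<in> range c)" for n by auto
  then show ?thesis using assms by (simp add: RE_def)
qed

text \<open>If values are encoded by their code words, a function is computable as soon as its
  code words are.\<close>

lemma computable_via_code:
  assumes c: "\<And>y. enc y = enc (c y)" and inj: "\<And>y z. c y = c z \<longleftrightarrow> y = z"
    and "computable (\<lambda>x. c (f x))"
  shows "computable f"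
proof (rule computableI)
  have "computable c"
    by (rule computable_code[where g = "\<lambda>x. x"]) (simp_all add: c[symmetric] cmp_intros)
  then have "computable (\<lambda>z. c (snd z))"
    by (rule computable_comp) (intro re)
  moreover have "computable (\<lambda>z. c (f (fst z)))"
    by (rule computable_comp[OF assms(3)]) (intro re)
  ultimately have "RE (\<lambda>z. c (snd z) = c (f (fst z)))" by (rule RE_eq)
  then show "RE (\<lambda>z. snd z = f (fst z))" by (simp add: inj)
qed

text \<open>With code words as codes, \<open>tm_code\<close> is the identity on codes and the
  constructors are concatenations of words.\<close>

instantiation tm :: enc
begin
definition "enc t = enc (tm_code t)"
instance
  by standard (simp_all add: enc_tm_def inj_tm_code RE0_range_code[OF RE_range_tm_code])
end

lemma computable_tm_code [re]: "computable f \<Longrightarrow> computable (\<lambda>x. tm_code (f x))"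
  by (rule computable_comp, rule computable_code[where g = "\<lambda>x. x"])
    (auto simp: enc_tm_def intro: cmp_intros)

lemmas computable_tmI = computable_via_code[where c = tm_code, OF enc_tm_def inj_tm_code]

lemma [re]: "computable f \<Longrightarrow> computable (\<lambda>x. Var (f x))"
  and [re]: "computable g \<Longrightarrow> computable (\<lambda>x. Exp (g x))"
  by (rule computable_tmI; simp only: tm_code.simps; intro re; assumption)+

lemma [re]:
  assumes "computable f" "computable g"
  shows "computable (\<lambda>x. Add (f x) (g x))" "computable (\<lambda>x. Mul (f x) (g x))"
  by (rule computable_tmI; simp only: tm_code.simps; intro re assms)+

lemma RE_range_fm_code: "RE (\<lambda>w. w \<in> range fm_code)"
proof (rule RE_rules[where m = length and R = "\<lambda>w ps.
    (\<exists>s t. w = [False, False, False] @ tm_code s @ tm_code t \<and> ps = []) \<or>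
    (\<exists>s t. w = [False, False, True] @ tm_code s @ tm_code t \<and> ps = []) \<or>
    (\<exists>u v. w = [False, True, False] @ u @ v \<and> ps = [u, v]) \<or>
    (\<exists>u v. w = [False, True, True] @ u @ v \<and> ps = [u, v]) \<or>
    (\<exists>i u. w = [True, False, False] @ idx_code i @ u \<and> ps = [u])"], goal_cases)
  case 1
  show ?case by (intro re)
next
  case (2 w ps)
  have "[False, True, False] @ u @ v \<in> range fm_code" "[False, True, True] @ u @ v \<in> range fm_code"
    "[True, False, False] @ idx_code i @ u \<in> range fm_code"
    if "u \<in> range fm_code" "v \<in> range fm_code" for i u v
    using that by (elim rangeE; simp only: fm_code.simps(3-)[symmetric] rangeI)+
  moreover have "[False, False, False] @ tm_code s @ tm_code t \<in> range fm_code"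
    "[False, False, True] @ tm_code s @ tm_code t \<in> range fm_code" for s t
    by (simp_all only: fm_code.simps[symmetric] rangeI)
  ultimately show ?case using 2 by (elim disjE exE conjE) simp_all
next
  case (3 w)
  then obtain p where w: "w = fm_code p" by auto
  show ?case
  proof (cases p)
    case (And q r)
    with w show ?thesis by (intro exI[of _ "[fm_code q, fm_code r]"]) auto
  next
    case (Or q r)
    with w show ?thesis by (intro exI[of _ "[fm_code q, fm_code r]"]) auto
  next
    case (Exi i q)
    with w show ?thesis by (intro exI[of _ "[fm_code q]"]) auto
  qed (use w in auto)
qed

instantiation fm :: enc
begin
definition "enc p = enc (fm_code p)"
instance
  by standard (simp_all add: enc_fm_def fm_code_eq_iff RE0_range_code[OF RE_range_fm_code])
end

lemma computable_fm_code [re]: "computable f \<Longrightarrow> computable (\<lambda>x. fm_code (f x))"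
  by (rule computable_comp, rule computable_code[where g = "\<lambda>x. x"])
    (auto simp: enc_fm_def intro: cmp_intros)

lemmas computable_fmI = computable_via_code[where c = fm_code, OF enc_fm_def fm_code_eq_iff]

lemma [re]:
  assumes "computable f" "computable g"
  shows "computable (\<lambda>x. Less (f x) (g x))" "computable (\<lambda>x. Eql (f x) (g x))"
  by (rule computable_fmI; simp only: fm_code.simps; intro re assms)+

lemma [re]:
  assumes "computable f" "computable g"
  shows "computable (\<lambda>x. And (f x) (g x))" "computable (\<lambda>x. Or (f x) (g x))"
  by (rule computable_fmI; simp only: fm_code.simps; intro re assms)+

lemma [re]:
  assumes "computable f" "computable g"
  shows "computable (\<lambda>x. Exi (f x) (g x))"
  by (rule computable_fmI; simp only: fm_code.simps; intro re assms)

section \<open>Syntactic conditions on formulas\<close>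

lemma RE_eq_free: "RE eq_free"
proof (rule RE_rules[where m = size and R = "\<lambda>q ps.
    (\<exists>s t. q = Less s t \<and> ps = []) \<or>
    (\<exists>p p'. q = And p p' \<and> ps = [p, p']) \<or>
    (\<exists>p p'. q = Or p p' \<and> ps = [p, p']) \<or>
    (\<exists>i p. q = Exi i p \<and> ps = [p])"], goal_cases)
  case (3 q)
  then show ?case by (cases q) auto
qed (auto intro!: re)

lemma RE_tm_vars_subset: "RE (\<lambda>(t, is). tm_vars t \<subseteq> set is)"
proof (rule RE_rules[where m = "\<lambda>z. size (fst z)" and R = "\<lambda>z ps. \<exists>is.
    (\<exists>i. z = (Var i, is) \<and> i \<in> set is \<and> ps = []) \<or>
    (z = (Zero, is) \<and> ps = []) \<or> (z = (One, is) \<and> ps = []) \<or>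
    (\<exists>s t. z = (Add s t, is) \<and> ps = [(s, is), (t, is)]) \<or>
    (\<exists>s t. z = (Mul s t, is) \<and> ps = [(s, is), (t, is)]) \<or>
    (\<exists>t. z = (Exp t, is) \<and> ps = [(t, is)])"], goal_cases)
  case 1
  show ?case by (intro re)
next
  case (3 z)
  then show ?case by (cases z; cases "fst z") auto
qed auto

lemma RE_tm_vars [re]: "computable f \<Longrightarrow> computable g \<Longrightarrow> RE (\<lambda>x. tm_vars (f x) \<subseteq> set (g x))"
  by (rule RE_comp2) (use RE_tm_vars_subset in \<open>simp_all add: case_prod_beta'\<close>)

text \<open>Being closed is not inherited by the body of a quantifier, but an upper bound for the
  free variables is, once the bound variable is added to it. Sentences are the case of the empty
  list.\<close>

lemma RE_fm_free_subset: "RE (\<lambda>(p, is). fm_free p \<subseteq> set is)"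
proof (rule RE_rules[where m = "\<lambda>z. size (fst z)" and R = "\<lambda>z ps. \<exists>is.
    (\<exists>s t. z = (Less s t, is) \<and> tm_vars s \<subseteq> set is \<and> tm_vars t \<subseteq> set is \<and> ps = []) \<or>
    (\<exists>s t. z = (Eql s t, is) \<and> tm_vars s \<subseteq> set is \<and> tm_vars t \<subseteq> set is \<and> ps = []) \<or>
    (\<exists>p q. z = (And p q, is) \<and> ps = [(p, is), (q, is)]) \<or>
    (\<exists>p q. z = (Or p q, is) \<and> ps = [(p, is), (q, is)]) \<or>
    (\<exists>i p. z = (Exi i p, is) \<and> ps = [(p, i # is)])"], goal_cases)
  case 1
  show ?case by (intro re)
next
  case (2 z ps)
  then show ?case by auto
next
  case (3 z)
  then show ?case by (cases z; cases "fst z") (auto simp: subset_iff)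
qed

lemma RE_sentence: "RE sentence"
proof -
  have "RE (\<lambda>p. (\<lambda>(p, is). fm_free p \<subseteq> set is) (p, []))"
    by (intro RE_comp[OF RE_fm_free_subset] re)
  then show ?thesis by (simp add: sentence_def[abs_def])
qed

lemma computable_str_code [re]:
  assumes "computable f"
  shows "computable (\<lambda>x. str_code (f x))"
proof (rule computable_graph1[OF _ assms])
  show "RE (\<lambda>(w, n). n = str_code w)"
  proof (rule RE_rules[where m = "\<lambda>z. length (fst z)" and R = "\<lambda>z ps.
      (z = ([], 0) \<and> ps = []) \<or>
      (\<exists>w n. z = (True # w, Suc (Suc (n + n))) \<and> ps = [(w, n)]) \<or>
      (\<exists>w n. z = (False # w, Suc (n + n)) \<and> ps = [(w, n)])"], goal_cases)
    case (3 z)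
    then obtain w where "z = (w, str_code w)" by (cases z) auto
    then show ?case
    proof (cases w)
      case (Cons b v)
      then show ?thesis
        using \<open>z = _\<close> by (intro exI[of _ "[(v, str_code v)]"]) auto
    qed auto
  qed (auto intro!: re)
qed

section \<open>Evaluation of terms at rational points\<close>

text \<open>The triple \<open>(a, b, c)\<close> stands for the rational number \<open>(a - b) / (c + 1)\<close>.\<close>

type_synonym frac = "nat \<times> nat \<times> nat"

definition fval :: "frac \<Rightarrow> real" where
  "fval x = (real (fst x) - real (fst (snd x))) / (real (snd (snd x)) + 1)"

definition fadd :: "frac \<Rightarrow> frac \<Rightarrow> frac" where
  "fadd x y = (fst x * Suc (snd (snd y)) + fst y * Suc (snd (snd x)),
    fst (snd x) * Suc (snd (snd y)) + fst (snd y) * Suc (snd (snd x)),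
    snd (snd x) * snd (snd y) + snd (snd x) + snd (snd y))"

definition fmult :: "frac \<Rightarrow> frac \<Rightarrow> frac" where
  "fmult x y = (fst x * fst y + fst (snd x) * fst (snd y),
    fst x * fst (snd y) + fst (snd x) * fst y,
    snd (snd x) * snd (snd y) + snd (snd x) + snd (snd y))"

definition fneg :: "frac \<Rightarrow> frac" where
  "fneg x = (fst (snd x), fst x, snd (snd x))"

primrec fpow :: "frac \<Rightarrow> nat \<Rightarrow> frac" where
  "fpow x 0 = (1, 0, 0)"
| "fpow x (Suc n) = fmult x (fpow x n)"

lemma denominators: "real (c * c' + c + c') + 1 = (real c + 1) * (real c' + 1)"
  by (simp add: algebra_simps)

lemma fval_fadd [simp]: "fval (fadd x y) = fval x + fval y"
  unfolding fval_def fadd_def fst_conv snd_conv denominators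
  by (simp add: add_frac_eq add_pos_nonneg less_imp_neq[symmetric]) (simp add: algebra_simps)

lemma fval_fmult [simp]: "fval (fmult x y) = fval x * fval y"
  unfolding fval_def fmult_def fst_conv snd_conv denominators
  by (simp add: algebra_simps)

lemma fval_fneg [simp]: "fval (fneg x) = - fval x"
  by (simp add: fval_def fneg_def minus_divide_left)

lemma fval_fpow [simp]: "fval (fpow x n) = fval x ^ n"
  by (induction n) (simp_all, simp add: fval_def)

lemma fval_of_nat [simp]: "fval (n, 0, 0) = real n" "fval (0, n, 0) = - real n"
  and fval_inverse [simp]: "fval (1, 0, n) = 1 / (real n + 1)" "fval (Suc 0, 0, n) = 1 / (real n + 1)"
  by (simp_all add: fval_def)

text \<open>Clearing denominators and moving the negative parts across leaves an inequality of
  natural numbers.\<close>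

lemma fval_less_iff: "fval x < fval y \<longleftrightarrow>
    fst x * Suc (snd (snd y)) + fst (snd y) * Suc (snd (snd x)) <
    fst y * Suc (snd (snd x)) + fst (snd x) * Suc (snd (snd y))"
proof -
  obtain a b c where x: "x = (a, b, c)" by (cases x) auto
  obtain a' b' c' where y: "y = (a', b', c')" by (cases y) auto
  have "fval x < fval y \<longleftrightarrow> (real a - real b) * (real c' + 1) < (real a' - real b') * (real c + 1)"
    by (simp add: x y fval_def frac_less_eq divide_less_eq less_divide_eq mult.commute add_pos_nonneg)
  also have "\<dots> \<longleftrightarrow> real (a * Suc c' + b' * Suc c) < real (a' * Suc c + b * Suc c')"
    by (simp add: algebra_simps)
  finally show ?thesis unfolding of_nat_less_iff by (simp add: x y)
qed

lemma fval_dense: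
  assumes "r < s"
  shows "\<exists>x. r < fval x \<and> fval x < s"
proof -
  obtain q where q: "q \<in> \<rat>" "r < q" "q < s" using Rats_dense_in_real[OF assms] by blast
  then obtain a b :: int where ab: "b > 0" "q = of_int a / of_int b" by (elim Rats_cases') auto
  \<comment> \<open>At most one of \<open>nat a\<close> and \<open>nat (- a)\<close> is nonzero, so
    their difference is a.\<close>
  have "fval (nat a, nat (- a), nat b - 1) = q"
    using ab by (simp add: fval_def of_nat_diff)
  then show ?thesis using q by metis
qed

text \<open>Strictness on each side lets the members of the sequences serve as enclosures, while
  their limits let continuity make these as tight as desired.\<close>

lemma fval_sequences:
  obtains l u where "\<And>n :: nat. fval (l n) < r" "\<And>n :: nat. r < fval (u n)"
    and "(\<lambda>n. fval (l n)) \<longlonglongrightarrow> r" "(\<lambda>n. fval (u n)) \<longlonglongrightarrow> r"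
proof -
  have "\<exists>x. r - 1 / real (Suc n) < fval x \<and> fval x < r" for n by (rule fval_dense) simp
  then obtain l where l: "\<And>n. r - 1 / real (Suc n) < fval (l n) \<and> fval (l n) < r" by metis
  have "\<exists>x. r < fval x \<and> fval x < r + 1 / real (Suc n)" for n by (rule fval_dense) simp
  then obtain u where u: "\<And>n. r < fval (u n) \<and> fval (u n) < r + 1 / real (Suc n)" by metis
  have lim: "(\<lambda>n. 1 / real (Suc n)) \<longlonglongrightarrow> 0" using LIMSEQ_inverse_real_of_nat by (simp add: inverse_eq_divide)
  have "(\<lambda>n. fval (l n)) \<longlonglongrightarrow> r"
  proof (rule tendsto_sandwich[where f = "\<lambda>n. r - 1 / real (Suc n)" and h = "\<lambda>_. r"])
    show "(\<lambda>n. r - 1 / real (Suc n)) \<longlonglongrightarrow> r" using tendsto_diff[OF tendsto_const lim, of r] by simp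
  qed (auto intro!: always_eventually less_imp_le simp: l simp del: of_nat_Suc)
  moreover have "(\<lambda>n. fval (u n)) \<longlonglongrightarrow> r"
  proof (rule tendsto_sandwich[where f = "\<lambda>_. r" and h = "\<lambda>n. r + 1 / real (Suc n)"])
    show "(\<lambda>n. r + 1 / real (Suc n)) \<longlonglongrightarrow> r" using tendsto_add[OF tendsto_const lim, of r] by simp
  qed (auto intro!: always_eventually less_imp_le simp: u simp del: of_nat_Suc)
  ultimately show ?thesis using that l u by blast
qed

lemma computable_fadd [re]: "computable f \<Longrightarrow> computable g \<Longrightarrow> computable (\<lambda>x. fadd (f x) (g x))"
  unfolding fadd_def by (intro re)

lemma computable_fmult [re]: "computable f \<Longrightarrow> computable g \<Longrightarrow> computable (\<lambda>x. fmult (f x) (g x))"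
  unfolding fmult_def by (intro re)

lemma computable_fneg [re]: "computable f \<Longrightarrow> computable (\<lambda>x. fneg (f x))"
  unfolding fneg_def by (intro re)

lemma computable_fpow [re]:
  assumes "computable f" "computable g"
  shows "computable (\<lambda>x. fpow (f x) (g x))"
proof (rule computable_graph2[OF _ assms])
  show "RE (\<lambda>(x, n, y). y = fpow x n)"
  proof (rule RE_rules[where m = "\<lambda>z. fst (snd z)" and R = "\<lambda>z ps. \<exists>x.
      (z = (x, 0, 1, 0, 0) \<and> ps = []) \<or>
      (\<exists>n y. z = (x, Suc n, fmult x y) \<and> ps = [(x, n, y)])"], goal_cases)
    case (3 z)
    then obtain x n where "z = (x, n, fpow x n)" by (cases z) auto
    then show ?case by (cases n) (auto simp del: split_paired_Ex)
  qed (auto intro!: re)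
qed

lemma RE_fval_less [re]: "computable f \<Longrightarrow> computable g \<Longrightarrow> RE (\<lambda>x. fval (f x) < fval (g x))"
  unfolding fval_less_iff by (intro re)

section \<open>Rational environments and enclosures of term values\<close>

type_synonym env = "(nat \<times> frac) list"

text \<open>The default makes the empty environment the zero assignment, at which sentences are
  evaluated.\<close>

primrec lookup :: "env \<Rightarrow> nat \<Rightarrow> frac" where
  "lookup [] i = (0, 0, 0)"
| "lookup (b # e) i = (if fst b = i then snd b else lookup e i)"

definition asg :: "env \<Rightarrow> nat \<Rightarrow> real" where
  "asg e i = fval (lookup e i)"

lemma asg_Nil [simp]: "asg [] = (\<lambda>_. 0)"
  by (simp add: asg_def fun_eq_iff fval_def)

lemma asg_Cons [simp]: "asg ((i, x) # e) = (asg e)(i := fval x)"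
  by (auto simp: asg_def)

lemma computable_lookup [re]:
  assumes "computable f" "computable g"
  shows "computable (\<lambda>x. lookup (f x) (g x))"
proof (rule computable_graph2[OF _ assms])
  show "RE (\<lambda>(e, i, x). x = lookup e i)"
  proof (rule RE_rules[where m = "\<lambda>z. length (fst z)" and R = "\<lambda>z ps.
      (\<exists>i. z = ([], i, 0, 0, 0) \<and> ps = []) \<or>
      (\<exists>i x e. z = ((i, x) # e, i, x) \<and> ps = []) \<or>
      (\<exists>i x e j y. z = ((j, y) # e, i, x) \<and> j \<noteq> i \<and> ps = [(e, i, x)])"], goal_cases)
    case (3 z)
    then obtain e i where z: "z = (e, i, lookup e i)" by (cases z) auto
    show ?case
    proof (cases e)
      case (Cons b e')
      then show ?thesis
        using z by (cases b; cases "fst b = i") (auto simp del: split_paired_Ex)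
    qed (use z in auto)
  qed (auto intro!: re)
qed

definition encloses :: "tm \<Rightarrow> env \<Rightarrow> frac \<Rightarrow> frac \<Rightarrow> bool" where
  "encloses t e a b \<longleftrightarrow> fval a < tm_val (asg e) t \<and> tm_val (asg e) t < fval b"

text \<open>For fixed t the product is monotone in s, in a direction given by the sign of t, so one
  of the two ends is a lower bound.\<close>

lemma mult_between:
  fixes s t :: real
  assumes "x < s" "s < y" "a < x * t" "a < y * t"
  shows "a < s * t"
proof (cases "0 \<le> t")
  case True
  then show ?thesis using assms mult_right_mono[of x s t] by linarith
next
  case False
  then show ?thesis using assms mult_right_mono_neg[of s y t] by linarith
qed

text \<open>Applying the one-variable bound in each factor: a bilinear function on a box is bounded
  by its corner values.\<close>

lemma mult_lower:
  fixes s t :: real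
  assumes "x < s" "s < y" "x' < t" "t < y'"
    and "a < x * x'" "a < x * y'" "a < y * x'" "a < y * y'"
  shows "a < s * t"
proof (rule mult_between[OF assms(1,2)])
  show "a < x * t" "a < y * t"
    using mult_between[OF assms(3,4), of a x] mult_between[OF assms(3,4), of a y] assms(5-)
    by (simp_all add: mult.commute)
qed

lemma mult_upper:
  fixes s t :: real
  assumes "x < s" "s < y" "x' < t" "t < y'"
    and "x * x' < b" "x * y' < b" "y * x' < b" "y * y' < b"
  shows "s * t < b"
  using mult_lower[of "- y" "- s" "- x" x' t y' "- b"] assms by simp

text \<open>The upper bound comes from the same power inequality at -d, which bounds exp d by the
  reciprocal of \<open>(1 - d / real (Suc k)) ^ Suc k\<close>. Multiplying out by b keeps the test
  free of division.\<close>

lemma exp_bounds: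
  fixes c s d b :: real
  assumes "c < s" "s < d" "- real (Suc k) < c" "d < real (Suc k)"
    and a: "a < (1 + c / real (Suc k)) ^ Suc k" and b: "1 < b * (1 - d / real (Suc k)) ^ Suc k"
  shows "a < exp s" "exp s < b"
proof -
  have "(1 + c / real (Suc k)) ^ Suc k \<le> exp c"
    by (rule exp_ge_one_plus_x_over_n_power_n) (use assms in auto)
  also have "\<dots> < exp s" using assms by simp
  finally show "a < exp s" using a by simp
  have "(1 - d / real (Suc k)) ^ Suc k \<le> exp (- d)"
    using exp_ge_one_plus_x_over_n_power_n[of "Suc k" "- d"] assms by simp
  moreover have pos: "0 < (1 - d / real (Suc k)) ^ Suc k"
    by (rule zero_less_power) (use assms in \<open>simp add: divide_less_eq\<close>)
  moreover have "0 < b" using b pos by (metis less_trans zero_less_one zero_less_mult_pos2)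
  ultimately have "b * (1 - d / real (Suc k)) ^ Suc k \<le> b * exp (- d)" by (intro mult_left_mono) auto
  then have "1 < b * exp (- d)" using b by linarith
  then have "exp d < b" by (simp add: exp_minus divide_inverse[symmetric] less_divide_eq)
  then show "exp s < b" using assms by (meson exp_less_cancel_iff less_trans)
qed

text \<open>Rational c and d close to s still satisfy a < exp c and exp d < b; with these fixed, the
  powers converge to exp c and exp (-d), and a large exponent keeps the strict inequalities.\<close>

lemma exp_bounds_exist:
  fixes s a b :: real
  assumes "a < exp s" "exp s < b"
  shows "\<exists>k c d. fval c < s \<and> s < fval d \<and> - real (Suc k) < fval c \<and> fval d < real (Suc k) \<and>
    a < (1 + fval c / real (Suc k)) ^ Suc k \<and> 1 < b * (1 - fval d / real (Suc k)) ^ Suc k"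
proof -
  obtain l u where lu: "\<And>n :: nat. fval (l n) < s" "\<And>n. s < fval (u n)"
      "(\<lambda>n. fval (l n)) \<longlonglongrightarrow> s" "(\<lambda>n. fval (u n)) \<longlonglongrightarrow> s"
    using fval_sequences[of s] by metis
  have "\<forall>\<^sub>F n in sequentially. a < exp (fval (l n))"
    by (rule order_tendstoD(1)[OF tendsto_exp[OF lu(3)] assms(1)])
  then obtain m where m: "a < exp (fval (l m))" by (rule eventually_happens'[OF sequentially_bot, THEN exE])
  have "\<forall>\<^sub>F n in sequentially. exp (fval (u n)) < b"
    by (rule order_tendstoD(2)[OF tendsto_exp[OF lu(4)] assms(2)])
  then obtain m' where m': "exp (fval (u m')) < b" by (rule eventually_happens'[OF sequentially_bot, THEN exE])
  define c d where "c = fval (l m)" and "d = fval (u m')"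
  have 1: "1 < b * exp (- d)" using m' by (simp add: d_def exp_minus divide_inverse[symmetric] less_divide_eq)
  have limc: "(\<lambda>n. (1 + c / real n) ^ n) \<longlonglongrightarrow> exp c" by (rule tendsto_exp_limit_sequentially)
  have "(\<lambda>n. (1 + (- d) / real n) ^ n) \<longlonglongrightarrow> exp (- d)" by (rule tendsto_exp_limit_sequentially)
  then have "(\<lambda>n. b * (1 + (- d) / real n) ^ n) \<longlonglongrightarrow> b * exp (- d)" by (intro tendsto_intros)
  then have "\<forall>\<^sub>F n in sequentially. 1 < b * (1 + (- d) / real n) ^ n" using 1 by (rule order_tendstoD(1))
  moreover have "\<forall>\<^sub>F n in sequentially. a < (1 + c / real n) ^ n"
    using m by (intro order_tendstoD(1)[OF limc]) (simp add: c_def)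
  \<comment> \<open>This puts c and d inside the range required by \<open>exp_bounds\<close> and
    makes n a successor.\<close>
  moreover have "\<forall>\<^sub>F n in sequentially. n > nat \<lceil>\<bar>c\<bar>\<rceil> + nat \<lceil>\<bar>d\<bar>\<rceil>"
    by (rule eventually_gt_at_top)
  ultimately have "\<forall>\<^sub>F n in sequentially. 1 < b * (1 + (- d) / real n) ^ n \<and> a < (1 + c / real n) ^ n \<and>
      n > nat \<lceil>\<bar>c\<bar>\<rceil> + nat \<lceil>\<bar>d\<bar>\<rceil>"
    by eventually_elim blast
  then obtain n where "1 < b * (1 + (- d) / real n) ^ n \<and> a < (1 + c / real n) ^ n \<and>
      n > nat \<lceil>\<bar>c\<bar>\<rceil> + nat \<lceil>\<bar>d\<bar>\<rceil>"
    by (rule eventually_happens'[OF sequentially_bot, THEN exE])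
  then have n: "1 < b * (1 + (- d) / real n) ^ n" "a < (1 + c / real n) ^ n"
      "n > nat \<lceil>\<bar>c\<bar>\<rceil> + nat \<lceil>\<bar>d\<bar>\<rceil>"
    by blast+
  then obtain k where k: "n = Suc k" by (cases n) auto
  have "- real n < c" "d < real n" using n(3) by linarith+
  then show ?thesis
    using n lu by (intro exI[of _ k] exI[of _ "l m"] exI[of _ "u m'"]) (simp add: c_def d_def k)
qed

lemma encloses_exists: "\<exists>a b. encloses t e a b"
  unfolding encloses_def using fval_dense[of "tm_val (asg e) t - 1" "tm_val (asg e) t"]
    fval_dense[of "tm_val (asg e) t" "tm_val (asg e) t + 1"] by auto

text \<open>Right to left is soundness of the rule for \<open>encloses\<close>, left to right its
  completeness: any enclosure of the sum, however tight, comes from sufficiently tight enclosures of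
  the summands. The cases of \<open>Mul\<close> and \<open>Exp\<close> follow the same plan.\<close>

lemma encloses_Add_iff:
  "encloses (Add s t) e a b \<longleftrightarrow> (\<exists>a1 b1 a2 b2. encloses s e a1 b1 \<and> encloses t e a2 b2 \<and>
    fval a < fval (fadd a1 a2) \<and> fval (fadd b1 b2) < fval b)"
proof
  assume *: "encloses (Add s t) e a b"
  obtain l u where lu: "\<And>n :: nat. fval (l n) < tm_val (asg e) s" "\<And>n. tm_val (asg e) s < fval (u n)"
      "(\<lambda>n. fval (l n)) \<longlonglongrightarrow> tm_val (asg e) s" "(\<lambda>n. fval (u n)) \<longlonglongrightarrow> tm_val (asg e) s"
    using fval_sequences[of "tm_val (asg e) s"] by metis
  obtain l' u' where lu': "\<And>n :: nat. fval (l' n) < tm_val (asg e) t" "\<And>n. tm_val (asg e) t < fval (u' n)"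
      "(\<lambda>n. fval (l' n)) \<longlonglongrightarrow> tm_val (asg e) t" "(\<lambda>n. fval (u' n)) \<longlonglongrightarrow> tm_val (asg e) t"
    using fval_sequences[of "tm_val (asg e) t"] by metis
  have "\<forall>\<^sub>F n in sequentially. fval a < fval (l n) + fval (l' n)"
    using * by (intro order_tendstoD(1)[OF tendsto_add[OF lu(3) lu'(3)]]) (simp add: encloses_def)
  moreover have "\<forall>\<^sub>F n in sequentially. fval (u n) + fval (u' n) < fval b"
    using * by (intro order_tendstoD(2)[OF tendsto_add[OF lu(4) lu'(4)]]) (simp add: encloses_def)
  ultimately have "\<forall>\<^sub>F n in sequentially. fval a < fval (l n) + fval (l' n) \<and> fval (u n) + fval (u' n) < fval b"
    by (rule eventually_conj)
  then obtain n where "fval a < fval (l n) + fval (l' n) \<and> fval (u n) + fval (u' n) < fval b"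
    by (rule eventually_happens'[OF sequentially_bot, THEN exE])
  then show "\<exists>a1 b1 a2 b2. encloses s e a1 b1 \<and> encloses t e a2 b2 \<and>
    fval a < fval (fadd a1 a2) \<and> fval (fadd b1 b2) < fval b"
    using lu lu' unfolding encloses_def fval_fadd by blast
qed (force simp: encloses_def)

text \<open>The signs of the factors are unknown, so all four corner products are tested; each of
  them tends to the product of the values as the enclosures shrink.\<close>

lemma encloses_Mul_iff:
  "encloses (Mul s t) e a b \<longleftrightarrow> (\<exists>a1 b1 a2 b2. encloses s e a1 b1 \<and> encloses t e a2 b2 \<and>
    (fval a < fval (fmult a1 a2) \<and> fval (fmult a1 a2) < fval b) \<and>
    (fval a < fval (fmult a1 b2) \<and> fval (fmult a1 b2) < fval b) \<and>
    (fval a < fval (fmult b1 a2) \<and> fval (fmult b1 a2) < fval b) \<and>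
    (fval a < fval (fmult b1 b2) \<and> fval (fmult b1 b2) < fval b))"
proof
  assume *: "encloses (Mul s t) e a b"
  obtain l u where lu: "\<And>n :: nat. fval (l n) < tm_val (asg e) s" "\<And>n. tm_val (asg e) s < fval (u n)"
      "(\<lambda>n. fval (l n)) \<longlonglongrightarrow> tm_val (asg e) s" "(\<lambda>n. fval (u n)) \<longlonglongrightarrow> tm_val (asg e) s"
    using fval_sequences[of "tm_val (asg e) s"] by metis
  obtain l' u' where lu': "\<And>n :: nat. fval (l' n) < tm_val (asg e) t" "\<And>n. tm_val (asg e) t < fval (u' n)"
      "(\<lambda>n. fval (l' n)) \<longlonglongrightarrow> tm_val (asg e) t" "(\<lambda>n. fval (u' n)) \<longlonglongrightarrow> tm_val (asg e) t"
    using fval_sequences[of "tm_val (asg e) t"] by metis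
  have in_ab: "\<forall>\<^sub>F n in sequentially. fval a < f n * g n \<and> f n * g n < fval b"
    if "f \<longlonglongrightarrow> tm_val (asg e) s" "g \<longlonglongrightarrow> tm_val (asg e) t" for f g
    using * by (intro eventually_conj order_tendstoD[OF tendsto_mult[OF that]]) (simp_all add: encloses_def)
  have "\<forall>\<^sub>F n in sequentially. 
    (fval a < fval (l n) * fval (l' n) \<and> fval (l n) * fval (l' n) < fval b) \<and>
    (fval a < fval (l n) * fval (u' n) \<and> fval (l n) * fval (u' n) < fval b) \<and>
    (fval a < fval (u n) * fval (l' n) \<and> fval (u n) * fval (l' n) < fval b) \<and>
    (fval a < fval (u n) * fval (u' n) \<and> fval (u n) * fval (u' n) < fval b)"
    by (intro eventually_conj[OF in_ab] in_ab lu lu')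
  then obtain n where "
    (fval a < fval (l n) * fval (l' n) \<and> fval (l n) * fval (l' n) < fval b) \<and>
    (fval a < fval (l n) * fval (u' n) \<and> fval (l n) * fval (u' n) < fval b) \<and>
    (fval a < fval (u n) * fval (l' n) \<and> fval (u n) * fval (l' n) < fval b) \<and>
    (fval a < fval (u n) * fval (u' n) \<and> fval (u n) * fval (u' n) < fval b)"
    by (rule eventually_happens'[OF sequentially_bot, THEN exE])
  then show "\<exists>a1 b1 a2 b2. encloses s e a1 b1 \<and> encloses t e a2 b2 \<and>
    (fval a < fval (fmult a1 a2) \<and> fval (fmult a1 a2) < fval b) \<and>
    (fval a < fval (fmult a1 b2) \<and> fval (fmult a1 b2) < fval b) \<and>
    (fval a < fval (fmult b1 a2) \<and> fval (fmult b1 a2) < fval b) \<and>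
    (fval a < fval (fmult b1 b2) \<and> fval (fmult b1 b2) < fval b)"
    using lu lu' unfolding encloses_def fval_fmult by blast
next
  assume "\<exists>a1 b1 a2 b2. encloses s e a1 b1 \<and> encloses t e a2 b2 \<and>
    (fval a < fval (fmult a1 a2) \<and> fval (fmult a1 a2) < fval b) \<and>
    (fval a < fval (fmult a1 b2) \<and> fval (fmult a1 b2) < fval b) \<and>
    (fval a < fval (fmult b1 a2) \<and> fval (fmult b1 a2) < fval b) \<and>
    (fval a < fval (fmult b1 b2) \<and> fval (fmult b1 b2) < fval b)"
  then obtain a1 b1 a2 b2 where
      enc: "fval a1 < tm_val (asg e) s" "tm_val (asg e) s < fval b1"
        "fval a2 < tm_val (asg e) t" "tm_val (asg e) t < fval b2"
      and a: "fval a < fval a1 * fval a2" "fval a < fval a1 * fval b2"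
        "fval a < fval b1 * fval a2" "fval a < fval b1 * fval b2"
      and b: "fval a1 * fval a2 < fval b" "fval a1 * fval b2 < fval b"
        "fval b1 * fval a2 < fval b" "fval b1 * fval b2 < fval b"
    unfolding encloses_def fval_fmult by blast
  from mult_lower[OF enc a] mult_upper[OF enc b] show "encloses (Mul s t) e a b"
    by (simp add: encloses_def)
qed

lemma encloses_Exp_iff:
  "encloses (Exp t) e a b \<longleftrightarrow> (\<exists>k c d. encloses t e c d \<and>
    fval (0, Suc k, 0) < fval c \<and> fval d < fval (Suc k, 0, 0) \<and>
    fval a < fval (fpow (fadd (1, 0, 0) (fmult c (1, 0, k))) (Suc k)) \<and>
    fval (1, 0, 0) < fval (fmult b (fpow (fadd (1, 0, 0) (fneg (fmult d (1, 0, k)))) (Suc k))))"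
proof -
  have lower: "fval (fpow (fadd (1, 0, 0) (fmult c (1, 0, k))) (Suc k)) = (1 + fval c / real (Suc k)) ^ Suc k"
    and upper: "fval (fpow (fadd (1, 0, 0) (fneg (fmult c (1, 0, k)))) (Suc k)) = (1 - fval c / real (Suc k)) ^ Suc k"
    and one: "fval (1, 0, 0) = 1" for c k
    by (simp_all add: add.commute del: power_Suc fpow.simps)
  show ?thesis
    unfolding encloses_def lower fval_fmult upper one fval_of_nat of_nat_1 tm_val.simps
    using exp_bounds[of "fval c" "tm_val (asg e) t" "fval d" k "fval a" "fval b" for c d k]
      exp_bounds_exist[of "fval a" "tm_val (asg e) t" "fval b"] by blast
qed

text \<open>The rules are the preceding equivalences, with the enclosures of the subterms as guessed
  premises; the size of the term decreases.\<close>

lemma RE_encloses_tuple: "RE (\<lambda>(t, e, a, b). encloses t e a b)"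
proof (rule RE_rules[where m = "\<lambda>z. size (fst z)" and R = "\<lambda>z ps. \<exists>e a b.
    (\<exists>i. z = (Var i, e, a, b) \<and> fval a < fval (lookup e i) \<and> fval (lookup e i) < fval b \<and> ps = []) \<or>
    (z = (Zero, e, a, b) \<and> fval a < fval (0, 0, 0) \<and> fval (0, 0, 0) < fval b \<and> ps = []) \<or>
    (z = (One, e, a, b) \<and> fval a < fval (1, 0, 0) \<and> fval (1, 0, 0) < fval b \<and> ps = []) \<or>
    (\<exists>s t a1 b1 a2 b2. z = (Add s t, e, a, b) \<and>
      fval a < fval (fadd a1 a2) \<and> fval (fadd b1 b2) < fval b \<and> ps = [(s, e, a1, b1), (t, e, a2, b2)]) \<or>
    (\<exists>s t a1 b1 a2 b2. z = (Mul s t, e, a, b) \<and>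
      (fval a < fval (fmult a1 a2) \<and> fval (fmult a1 a2) < fval b) \<and>
      (fval a < fval (fmult a1 b2) \<and> fval (fmult a1 b2) < fval b) \<and>
      (fval a < fval (fmult b1 a2) \<and> fval (fmult b1 a2) < fval b) \<and>
      (fval a < fval (fmult b1 b2) \<and> fval (fmult b1 b2) < fval b) \<and> ps = [(s, e, a1, b1), (t, e, a2, b2)]) \<or>
    (\<exists>t k c d. z = (Exp t, e, a, b) \<and>
      fval (0, Suc k, 0) < fval c \<and> fval d < fval (Suc k, 0, 0) \<and>
      fval a < fval (fpow (fadd (1, 0, 0) (fmult c (1, 0, k))) (Suc k)) \<and>
      fval (1, 0, 0) < fval (fmult b (fpow (fadd (1, 0, 0) (fneg (fmult d (1, 0, k)))) (Suc k))) \<and>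
      ps = [(t, e, c, d)])"], goal_cases)
  case 1
  show ?case by (intro re)
next
  case (2 z ps)
  have base: "encloses (Var i) e a b \<longleftrightarrow> fval a < fval (lookup e i) \<and> fval (lookup e i) < fval b"
    "encloses Zero e a b \<longleftrightarrow> fval a < fval (0, 0, 0) \<and> fval (0, 0, 0) < fval b"
    "encloses One e a b \<longleftrightarrow> fval a < fval (1, 0, 0) \<and> fval (1, 0, 0) < fval b" for i e a b
    by (simp_all add: encloses_def asg_def fval_def)
  from 2 show ?case
    by (elim disjE exE conjE; simp only: prod.case list.set ball_simps simp_thms base
        encloses_Add_iff encloses_Mul_iff encloses_Exp_iff; blast)
next
  case (3 z)
  then obtain t e a b where z: "z = (t, e, a, b)" and enc: "encloses t e a b" by (cases z) auto
  show ?case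
  proof (cases t)
    case (Var i)
    with enc z show ?thesis by (auto simp: encloses_def asg_def)
  next
    case (Add s u)
    from enc obtain a1 b1 a2 b2 where "encloses s e a1 b1" "encloses u e a2 b2"
        "fval a < fval (fadd a1 a2)" "fval (fadd b1 b2) < fval b"
      unfolding Add encloses_Add_iff by blast
    then show ?thesis unfolding z Add by (intro exI[of _ "[(s, e, a1, b1), (u, e, a2, b2)]"]) (auto simp del: split_paired_Ex)
  next
    case (Mul s u)
    from enc obtain a1 b1 a2 b2 where "encloses s e a1 b1" "encloses u e a2 b2"
        "fval a < fval (fmult a1 a2)" "fval (fmult a1 a2) < fval b"
        "fval a < fval (fmult a1 b2)" "fval (fmult a1 b2) < fval b"
        "fval a < fval (fmult b1 a2)" "fval (fmult b1 a2) < fval b"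
        "fval a < fval (fmult b1 b2)" "fval (fmult b1 b2) < fval b"
      unfolding Mul encloses_Mul_iff by blast
    then show ?thesis unfolding z Mul by (intro exI[of _ "[(s, e, a1, b1), (u, e, a2, b2)]"]) (auto simp del: split_paired_Ex)
  next
    case (Exp s)
    from enc obtain k c d where "encloses s e c d"
        "fval (0, Suc k, 0) < fval c" "fval d < fval (Suc k, 0, 0)"
        "fval a < fval (fpow (fadd (1, 0, 0) (fmult c (1, 0, k))) (Suc k))"
        "fval (1, 0, 0) < fval (fmult b (fpow (fadd (1, 0, 0) (fneg (fmult d (1, 0, k)))) (Suc k)))"
      unfolding Exp encloses_Exp_iff by blast
    then show ?thesis unfolding z Exp
      by (intro exI[of _ "[(s, e, c, d)]"]) (auto simp del: power_Suc fpow.simps split_paired_Ex)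
  qed (use enc z in \<open>auto simp: encloses_def fval_def\<close>)
qed

lemma RE_encloses [re]:
  assumes "computable f" "computable g" "computable h" "computable k"
  shows "RE (\<lambda>x. encloses (f x) (g x) (h x) (k x))"
proof -
  have "RE (\<lambda>x. (\<lambda>(t, e, a, b). encloses t e a b) (f x, g x, h x, k x))"
    by (intro RE_comp[OF RE_encloses_tuple] re assms)
  then show ?thesis by simp
qed

section \<open>Approximate truth and its enumeration\<close>

text \<open>With parameters \<open>N\<close> and \<open>M\<close>, quantifiers range over rational points of absolute value
  below \<open>N + 1\<close>, equalities may fail by less than \<open>1 / (M + 1)\<close>, and the strict inequality
  \<open>s < t\<close> is replaced by \<open>s + 1 / (N + 1) \<le> t\<close> up to the same error. For \<open>M = N\<close> the two
  corrections of an inequality cancel.\<close>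

primrec approx :: "nat \<Rightarrow> nat \<Rightarrow> env \<Rightarrow> fm \<Rightarrow> bool" where
  "approx N M e (Less s t) \<longleftrightarrow>
    tm_val (asg e) s + 1 / (real N + 1) < tm_val (asg e) t + 1 / (real M + 1)"
| "approx N M e (Eql s t) \<longleftrightarrow>
    tm_val (asg e) s < tm_val (asg e) t + 1 / (real M + 1) \<and>
    tm_val (asg e) t < tm_val (asg e) s + 1 / (real M + 1)"
| "approx N M e (And p q) \<longleftrightarrow> approx N M e p \<and> approx N M e q"
| "approx N M e (Or p q) \<longleftrightarrow> approx N M e p \<or> approx N M e q"
| "approx N M e (Exi i p) \<longleftrightarrow> (\<exists>x. \<bar>fval x\<bar> < real N + 1 \<and> approx N M ((i, x) # e) p)"

text \<open>A strict inequality of reals is confirmed by separating rationals. The offsets will be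
  the gap and the tolerance of \<open>approx\<close>, with 0 in place of the gap for
  equations.\<close>

lemma offset_less_iff:
  "tm_val (asg e) s + fval x < tm_val (asg e) t + fval y \<longleftrightarrow>
    (\<exists>a b c d. encloses s e a b \<and> encloses t e c d \<and> fval (fadd b x) < fval (fadd c y))"
proof
  let ?s = "tm_val (asg e) s" and ?t = "tm_val (asg e) t"
  assume *: "?s + fval x < ?t + fval y"
  \<comment> \<open>Each side may use up half of the available slack.\<close>
  define h where "h = (?t + fval y - ?s - fval x) / 2"
  have h: "0 < h" using * by (simp add: h_def)
  obtain b where b: "?s < fval b" "fval b < ?s + h" using fval_dense[of ?s "?s + h"] h by auto
  obtain c where c: "?t - h < fval c" "fval c < ?t" using fval_dense[of "?t - h" ?t] h by auto
  obtain a d where "fval a < ?s" "?t < fval d"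
    using encloses_exists[of s e] encloses_exists[of t e] unfolding encloses_def by blast
  moreover have "fval (fadd b x) < fval (fadd c y)" using b c by (simp add: h_def field_simps)
  ultimately show "\<exists>a b c d. encloses s e a b \<and> encloses t e c d \<and> fval (fadd b x) < fval (fadd c y)"
    using b c unfolding encloses_def by blast
qed (force simp: encloses_def)

lemma abs_fval_less_iff:
  "\<bar>fval x\<bar> < real N + 1 \<longleftrightarrow> fval (0, Suc N, 0) < fval x \<and> fval x < fval (Suc N, 0, 0)"
  by auto

lemma RE_approx_tuple: "RE (\<lambda>(p, N, M, e). approx N M e p)"
proof (rule RE_rules[where m = "\<lambda>z. size (fst z)" and R = "\<lambda>z ps. \<exists>N M e.
    (\<exists>s t. z = (Less s t, N, M, e) \<and> (\<exists>a b c d. encloses s e a b \<and> encloses t e c d \<and>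
      fval (fadd b (1, 0, N)) < fval (fadd c (1, 0, M))) \<and> ps = []) \<or>
    (\<exists>s t. z = (Eql s t, N, M, e) \<and> (\<exists>a b c d. encloses s e a b \<and> encloses t e c d \<and>
      fval (fadd b (0, 0, 0)) < fval (fadd c (1, 0, M))) \<and> (\<exists>a b c d. encloses t e a b \<and> encloses s e c d \<and>
      fval (fadd b (0, 0, 0)) < fval (fadd c (1, 0, M))) \<and> ps = []) \<or>
    (\<exists>p q. z = (And p q, N, M, e) \<and> ps = [(p, N, M, e), (q, N, M, e)]) \<or>
    (\<exists>p q. z = (Or p q, N, M, e) \<and> (ps = [(p, N, M, e)] \<or> ps = [(q, N, M, e)])) \<or>
    (\<exists>i p x. z = (Exi i p, N, M, e) \<and> (fval (0, Suc N, 0) < fval x \<and> fval x < fval (Suc N, 0, 0)) \<and>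
      ps = [(p, N, M, (i, x) # e)])"], goal_cases)
  case 1
  show ?case by (intro re)
next
  case (2 z ps)
  from 2 show ?case
    unfolding offset_less_iff[symmetric] abs_fval_less_iff[symmetric]
    by (auto simp del: split_paired_Ex)
next
  case (3 z)
  then obtain p N M e where z: "z = (p, N, M, e)" and p: "approx N M e p" by (cases z) auto
  show ?case
  proof (cases p)
    case (Less s t)
    with p show ?thesis unfolding z offset_less_iff[symmetric] by (intro exI[of _ "[]"]) simp
  next
    case (Eql s t)
    with p show ?thesis unfolding z offset_less_iff[symmetric] by (intro exI[of _ "[]"]) simp
  next
    case (And q r)
    with p show ?thesis unfolding z by (intro exI[of _ "[(q, N, M, e), (r, N, M, e)]"]) simp
  next
    case (Or q r)
    with p consider "approx N M e q" | "approx N M e r" by auto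
    then show ?thesis
    proof cases
      case 1
      then show ?thesis unfolding z Or by (intro exI[of _ "[(q, N, M, e)]"]) simp
    next
      case 2
      then show ?thesis unfolding z Or by (intro exI[of _ "[(r, N, M, e)]"]) simp
    qed
  next
    case (Exi i q)
    then obtain x where "\<bar>fval x\<bar> < real N + 1" "approx N M ((i, x) # e) q" using p by auto
    then show ?thesis unfolding z Exi abs_fval_less_iff
      by (intro exI[of _ "[(q, N, M, (i, x) # e)]"]) (auto simp del: split_paired_Ex)
  qed
qed

lemma RE_approx [re]:
  assumes "computable f" "computable g" "computable h" "computable k"
  shows "RE (\<lambda>x. approx (f x) (g x) (h x) (k x))"
proof -
  have "RE (\<lambda>x. (\<lambda>(p, N, M, e). approx N M e p) (k x, f x, g x, h x))"
    by (intro RE_comp[OF RE_approx_tuple] re assms)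
  then show ?thesis by simp
qed

section \<open>Truth from approximate truth\<close>

lemma tm_val_cong: "(\<And>i. i \<in> tm_vars t \<Longrightarrow> e i = e' i) \<Longrightarrow> tm_val e t = tm_val e' t"
  by (induction t) auto

lemma fm_holds_cong: "(\<And>i. i \<in> fm_free p \<Longrightarrow> e i = e' i) \<Longrightarrow> fm_holds e p \<longleftrightarrow> fm_holds e' p"
proof (induction p arbitrary: e e')
  case (Less s t)
  have "tm_val e s = tm_val e' s" "tm_val e t = tm_val e' t"
    by (rule tm_val_cong; simp add: Less)+
  then show ?case by simp
next
  case (Eql s t)
  have "tm_val e s = tm_val e' s" "tm_val e t = tm_val e' t"
    by (rule tm_val_cong; simp add: Eql)+
  then show ?case by simp
next
  case (And p q)
  have "fm_holds e p \<longleftrightarrow> fm_holds e' p" "fm_holds e q \<longleftrightarrow> fm_holds e' q"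
    by (rule And.IH; simp add: And.prems)+
  then show ?case by simp
next
  case (Or p q)
  have "fm_holds e p \<longleftrightarrow> fm_holds e' p" "fm_holds e q \<longleftrightarrow> fm_holds e' q"
    by (rule Or.IH; simp add: Or.prems)+
  then show ?case by simp
next
  case (Exi i p)
  have "fm_holds (e(i := x)) p \<longleftrightarrow> fm_holds (e'(i := x)) p" for x
    by (rule Exi.IH) (use Exi.prems in auto)
  then show ?case by simp
qed

lemma true_sentence_iff: "true_sentence p \<longleftrightarrow> sentence p \<and> fm_holds (\<lambda>_. 0) p"
  unfolding true_sentence_def sentence_def using fm_holds_cong[of p] by blast

text \<open>A larger N widens the boxes and shrinks the gap, and formulas contain no negation that
  could reverse the effect.\<close>

lemma approx_mono:
  assumes "approx N M e p" "N \<le> N'"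
  shows "approx N' M e p"
  using assms(1)
proof (induction p arbitrary: e)
  case (Less s t)
  have "1 / (real N' + 1) \<le> 1 / (real N + 1)" using assms(2) by (intro divide_left_mono) auto
  with Less show ?case by simp
next
  case (Exi i p)
  then obtain x where "\<bar>fval x\<bar> < real N + 1" "approx N M ((i, x) # e) p" by auto
  then have "\<bar>fval x\<bar> < real N' + 1" "approx N' M ((i, x) # e) p" using Exi.IH assms(2) by auto
  then show ?case unfolding approx.simps by blast
qed auto

lemma fm_holds_if_approx_diagonal: "eq_free p \<Longrightarrow> approx N N e p \<Longrightarrow> fm_holds (asg e) p"
proof (induction p arbitrary: e)
  case (Exi i p)
  then show ?case by (metis approx.simps(5) asg_Cons eq_free.simps(5) fm_holds.simps(5))
qed auto

text \<open>\<open>approx\<close> sees rational environments only, so a real assignment enters as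
  the pointwise limit of such environments.\<close>

definition converges :: "(nat \<Rightarrow> env) \<Rightarrow> (nat \<Rightarrow> real) \<Rightarrow> bool" where
  "converges e E \<longleftrightarrow> (\<forall>i. (\<lambda>k. asg (e k) i) \<longlonglongrightarrow> E i)"

lemma tendsto_tm_val: "converges e E \<Longrightarrow> (\<lambda>k. tm_val (asg (e k)) t) \<longlonglongrightarrow> tm_val E t"
  by (induction t) (auto simp: converges_def intro!: tendsto_intros)

lemma converges_Cons:
  "converges e E \<Longrightarrow> (\<lambda>k. fval (x k)) \<longlonglongrightarrow> y \<Longrightarrow> converges (\<lambda>k. (i, x k) # e k) (E(i := y))"
  by (simp add: converges_def)

lemma converges_subseq: "converges e E \<Longrightarrow> strict_mono r \<Longrightarrow> converges (\<lambda>k. e (r k)) E"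
  unfolding converges_def using LIMSEQ_subseq_LIMSEQ[of "\<lambda>k. asg (e k) _", unfolded comp_def] by fast

text \<open>The order of quantifiers matters: N depends on E and p alone, and only the index from
  which the approximation holds may depend on M. Arbitrary convergent environments are needed
  because real witnesses must be replaced by rational sequences.\<close>

lemma eventually_approx:
  "fm_holds E p \<Longrightarrow> \<exists>N. \<forall>M e. converges e E \<longrightarrow> (\<forall>\<^sub>F k in sequentially. approx N M (e k) p)"
proof (induction p arbitrary: E)
  case (Less s t)
  then have "0 < tm_val E t - tm_val E s" by simp
  \<comment> \<open>A gap below the true difference works for every M, as the tolerance only
    helps.\<close>
  then obtain N where N: "inverse (real (Suc N)) < tm_val E t - tm_val E s"
    using reals_Archimedean by blast
  show ?case
  proof (intro exI[of _ N] allI impI)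
    fix M e assume "converges e E"
    then have "(\<lambda>k. tm_val (asg (e k)) t - tm_val (asg (e k)) s) \<longlonglongrightarrow> tm_val E t - tm_val E s"
      by (intro tendsto_diff tendsto_tm_val)
    from order_tendstoD(1)[OF this N]
    show "\<forall>\<^sub>F k in sequentially. approx N M (e k) (Less s t)"
    proof eventually_elim
      case (elim k)
      have "0 < 1 / (real M + 1)" "inverse (real (Suc N)) = 1 / (real N + 1)"
        by (simp_all add: inverse_eq_divide)
      with elim show ?case unfolding approx.simps by linarith
    qed
  qed
next
  case (Eql s t)
  \<comment> \<open>The condition for an equation does not mention N, so any value will do.\<close>
  show ?case
  proof (intro exI[of _ 0] allI impI)
    fix M e assume "converges e E"
    then have lim: "(\<lambda>k. tm_val (asg (e k)) t - tm_val (asg (e k)) s) \<longlonglongrightarrow> tm_val E t - tm_val E s"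
      by (intro tendsto_diff tendsto_tm_val)
    have "tm_val E t - tm_val E s < 1 / (real M + 1)" "- (1 / (real M + 1)) < tm_val E t - tm_val E s"
      using Eql by simp_all
    from order_tendstoD(2)[OF lim this(1)] order_tendstoD(1)[OF lim this(2)]
    show "\<forall>\<^sub>F k in sequentially. approx 0 M (e k) (Eql s t)"
      by eventually_elim auto
  qed
next
  case (And p q)
  then have "fm_holds E p" "fm_holds E q" by simp_all
  then obtain N N' where N: "\<forall>M e. converges e E \<longrightarrow> (\<forall>\<^sub>F k in sequentially. approx N M (e k) p)"
    and N': "\<forall>M e. converges e E \<longrightarrow> (\<forall>\<^sub>F k in sequentially. approx N' M (e k) q)"
    using And.IH by blast
  show ?case
  proof (intro exI[of _ "max N N'"] allI impI)
    fix M e assume "converges e E"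
    with N N' have "\<forall>\<^sub>F k in sequentially. approx N M (e k) p" "\<forall>\<^sub>F k in sequentially. approx N' M (e k) q"
      by blast+
    then show "\<forall>\<^sub>F k in sequentially. approx (max N N') M (e k) (And p q)"
      by eventually_elim (auto intro: approx_mono)
  qed
next
  case (Or p q)
  then consider "fm_holds E p" | "fm_holds E q" by auto
  then show ?case
  proof cases
    case 1
    from Or.IH(1)[OF this] show ?thesis by (fastforce elim: eventually_mono)
  next
    case 2
    from Or.IH(2)[OF this] show ?thesis by (fastforce elim: eventually_mono)
  qed
next
  case (Exi i p)
  then obtain x where "fm_holds (E(i := x)) p" by auto
  from Exi.IH[OF this] obtain N where
    N: "\<And>M e. converges e (E(i := x)) \<Longrightarrow> \<forall>\<^sub>F k in sequentially. approx N M (e k) p" by blast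
  obtain l where l: "(\<lambda>n :: nat. fval (l n)) \<longlonglongrightarrow> x" using fval_sequences by blast
  \<comment> \<open>The box must contain the real witness strictly inside, so that its rational
    approximants eventually lie in it.\<close>
  define N' where "N' = max N (nat \<lceil>\<bar>x\<bar>\<rceil>)"
  have "\<bar>x\<bar> < real N' + 1" unfolding N'_def by linarith
  with tendsto_rabs[OF l] have small: "\<forall>\<^sub>F k in sequentially. \<bar>fval (l k)\<bar> < real N' + 1"
    by (rule order_tendstoD(2))
  show ?case
  proof (intro exI[of _ N'] allI impI)
    fix M e assume "converges e E"
    then have "\<forall>\<^sub>F k in sequentially. approx N M ((i, l k) # e k) p"
      using N l by (blast intro: converges_Cons)
    with small show "\<forall>\<^sub>F k in sequentially. approx N' M (e k) (Exi i p)"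
    proof eventually_elim
      case (elim k)
      then have "approx N' M ((i, l k) # e k) p" by (auto simp: N'_def intro: approx_mono)
      with elim show ?case unfolding approx.simps by blast
    qed
  qed
qed

lemma tendsto_tolerance:
  assumes "\<And>k. k \<le> M k"
  shows "(\<lambda>k. 1 / (real (M k) + 1)) \<longlonglongrightarrow> 0"
proof (rule tendsto_sandwich[OF _ _ tendsto_const LIMSEQ_inverse_real_of_nat])
  show "\<forall>\<^sub>F k in sequentially. 1 / (real (M k) + 1) \<le> inverse (real (Suc k))"
    using assms by (intro always_eventually) (simp add: inverse_eq_divide frac_le)
qed simp

text \<open>The compactness argument. The condition \<open>k \<le> M k\<close>, weaker than
  equality, survives the passage to subsequences in the disjunction and quantifier cases, while N
  and with it the boxes and gaps stay fixed.\<close>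

lemma fm_holds_limit:
  assumes "converges e E" "\<And>k. k \<le> M k" "\<And>k. approx N (M k) (e k) p"
  shows "fm_holds E p"
  using assms
proof (induction p arbitrary: e E M)
  case (Less s t)
  \<comment> \<open>The tolerance vanishes in the limit and the fixed gap remains, which makes the
    inequality strict again.\<close>
  have "tm_val E s + 1 / (real N + 1) \<le> tm_val E t + 0"
  proof (rule LIMSEQ_le)
    show "(\<lambda>k. tm_val (asg (e k)) s + 1 / (real N + 1)) \<longlonglongrightarrow> tm_val E s + 1 / (real N + 1)"
      by (intro tendsto_intros tendsto_tm_val Less)
    show "(\<lambda>k. tm_val (asg (e k)) t + 1 / (real (M k) + 1)) \<longlonglongrightarrow> tm_val E t + 0"
      by (intro tendsto_add tendsto_tolerance tendsto_tm_val Less)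
  qed (use Less in \<open>auto intro: less_imp_le\<close>)
  moreover have "0 < 1 / (real N + 1)" by simp
  ultimately show ?case unfolding fm_holds.simps by linarith
next
  case (Eql s t)
  have "tm_val E s \<le> tm_val E t + 0"
    by (rule LIMSEQ_le[OF tendsto_tm_val[OF Eql(1)] tendsto_add[OF tendsto_tm_val[OF Eql(1)] tendsto_tolerance[OF Eql(2)]]])
      (use Eql in \<open>auto intro: less_imp_le\<close>)
  moreover have "tm_val E t \<le> tm_val E s + 0"
    by (rule LIMSEQ_le[OF tendsto_tm_val[OF Eql(1)] tendsto_add[OF tendsto_tm_val[OF Eql(1)] tendsto_tolerance[OF Eql(2)]]])
      (use Eql in \<open>auto intro: less_imp_le\<close>)
  ultimately show ?case by simp
next
  case (And p q)
  have "fm_holds E p"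
    by (rule And.IH(1)[OF And.prems(1,2)]) (use And.prems(3) in auto)
  moreover have "fm_holds E q"
    by (rule And.IH(2)[OF And.prems(1,2)]) (use And.prems(3) in auto)
  ultimately show ?case by simp
next
  case (Or p q)
  \<comment> \<open>By the pigeonhole principle one disjunct holds along a subsequence.\<close>
  have "infinite {k. approx N (M k) (e k) p} \<or> infinite {k. approx N (M k) (e k) q}"
  proof -
    have "{k. approx N (M k) (e k) p} \<union> {k. approx N (M k) (e k) q} = UNIV" using Or.prems(3) by auto
    then show ?thesis by (metis finite_Un infinite_UNIV_nat)
  qed
  moreover have subseq: "fm_holds E p'" if inf: "infinite {k. approx N (M k) (e k) p'}"
    and IH: "\<And>e E M. \<lbrakk>converges e E; \<And>k. k \<le> M k; \<And>k. approx N (M k) (e k) p'\<rbrakk> \<Longrightarrow> fm_holds E p'" for p'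
  proof -
    from infinite_enumerate[OF inf] obtain r where r: "strict_mono r" "\<And>k :: nat. approx N (M (r k)) (e (r k)) p'"
      by auto
    show ?thesis
    proof (rule IH)
      show "converges (\<lambda>k. e (r k)) E" using Or.prems(1) r(1) by (rule converges_subseq)
      show "k \<le> M (r k)" for k using seq_suble[OF r(1), of k] Or.prems(2)[of "r k"] by linarith
    qed (rule r)
  qed
  ultimately show ?case
  proof (elim disjE)
    assume "infinite {k. approx N (M k) (e k) p}"
    then have "fm_holds E p" by (rule subseq) (fact Or.IH(1))
    then show ?thesis by simp
  next
    assume "infinite {k. approx N (M k) (e k) q}"
    then have "fm_holds E q" by (rule subseq) (fact Or.IH(2))
    then show ?thesis by simp
  qed
next
  case (Exi i p)
  then have "\<forall>k. \<exists>x. \<bar>fval x\<bar> < real N + 1 \<and> approx N (M k) ((i, x) # e k) p" by simp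
  then obtain x where x: "\<And>k. \<bar>fval (x k)\<bar> < real N + 1" "\<And>k. approx N (M k) ((i, x k) # e k) p" by metis
  \<comment> \<open>Bolzano-Weierstrass: a bounded sequence has a monotone subsequence, which
    converges.\<close>
  obtain r where r: "strict_mono r" "monoseq (\<lambda>k. fval (x (r k)))"
    using seq_monosub[of "\<lambda>k. fval (x k)"] by blast
  have "Bseq (\<lambda>k. fval (x (r k)))"
    by (rule BseqI'[of _ "real N + 1"]) (use x in \<open>auto intro: less_imp_le\<close>)
  then obtain y where y: "(\<lambda>k. fval (x (r k))) \<longlonglongrightarrow> y"
    using Bseq_monoseq_convergent r(2) unfolding convergent_def by blast
  have "fm_holds (E(i := y)) p"
  proof (rule Exi.IH)
    show "converges (\<lambda>k. (i, x (r k)) # e (r k)) (E(i := y))"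
      by (intro converges_Cons y converges_subseq[OF Exi.prems(1) r(1)])
    show "k \<le> M (r k)" for k using seq_suble[OF r(1), of k] Exi.prems(2)[of "r k"] by linarith
  qed (rule x)
  then show ?case by auto
qed

lemma fm_holds_iff_approx: "fm_holds (\<lambda>_. 0) p \<longleftrightarrow> (\<exists>N. \<forall>M. approx N M [] p)"
proof
  have conv: "converges (\<lambda>_. []) (\<lambda>_. 0)" by (simp add: converges_def)
  {
    assume "fm_holds (\<lambda>_. 0) p"
    from eventually_approx[OF this] obtain N where
      "\<forall>M e. converges e (\<lambda>_. 0) \<longrightarrow> (\<forall>\<^sub>F k in sequentially. approx N M (e k) p)" ..
    \<comment> \<open>The constant environment makes eventual truth in k plain truth, for each M
      separately.\<close>
    then have "\<forall>M. \<forall>\<^sub>F k in sequentially. approx N M [] p" using conv by blast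
    then show "\<exists>N. \<forall>M. approx N M [] p" by auto
  next
    assume "\<exists>N. \<forall>M. approx N M [] p"
    then obtain N where "\<And>M. approx N M [] p" by blast
    then show "fm_holds (\<lambda>_. 0) p" by (intro fm_holds_limit[OF conv, of "\<lambda>k. k" N]) auto
  }
qed

lemma fm_holds_iff_approx_diagonal:
  assumes "eq_free p"
  shows "fm_holds (\<lambda>_. 0) p \<longleftrightarrow> (\<exists>N. approx N N [] p)"
  using fm_holds_if_approx_diagonal[OF assms, of _ "[]"] fm_holds_iff_approx[of p] by auto

section \<open>Turing machines\<close>

text \<open>Counting the steps supplies a measure; afterwards the count is quantified away.\<close>

lemma RE_rtranclp:
  assumes "RE (\<lambda>(c, d). S c d)"
  shows "RE (\<lambda>(c, d). S\<^sup>*\<^sup>* c d)"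
proof -
  have S: "RE (\<lambda>x. S (f x) (g x))" if "computable f" "computable g" for f g :: "'b::enc \<Rightarrow> 'a"
    by (rule RE_comp2[OF _ that]) (use assms in \<open>simp add: case_prod_beta'\<close>)
  have "RE (\<lambda>(n, c, d). (S ^^ n) c d)"
  proof (rule RE_rules[where m = fst and R = "\<lambda>z ps.
      (\<exists>c. z = (0, c, c) \<and> ps = []) \<or> (\<exists>n c d e. z = (Suc n, c, e) \<and> S c d \<and> ps = [(n, d, e)])"], goal_cases)
    case (3 z)
    then obtain n c e where z: "z = (n, c, e)" "(S ^^ n) c e" by (cases z) auto
    show ?case
    proof (cases n)
      case (Suc k)
      with z obtain d where "S c d" "(S ^^ k) d e" by (metis relpowp_Suc_D2)
      with z Suc show ?thesis by (intro exI[of _ "[(k, d, e)]"]) auto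
    qed (use z in auto)
  qed (auto intro!: re S relpowp_Suc_I2)
  then have "RE (\<lambda>z. (\<lambda>(n, c, d). (S ^^ n) c d) (snd z, fst (fst z), snd (fst z)))"
    by (rule RE_comp) (intro re)
  then have "RE (\<lambda>z. \<exists>n. (S ^^ n) (fst z) (snd z))"
    by (intro RE_ex) (simp add: case_prod_beta')
  then show ?thesis by (simp add: rtranclp_power case_prod_beta')
qed

lemma RE_finite_ex:
  "finite A \<Longrightarrow> (\<And>a. a \<in> A \<Longrightarrow> RE (P a)) \<Longrightarrow> RE (\<lambda>x. \<exists>a \<in> A. P a x)"
  by (induction A rule: finite_induct) (auto intro: re)

text \<open>The step relation is restricted to the finite domain of the transition table, because
  outside of it the transition function is arbitrary.\<close>

definition step_rel :: "turing_machine \<Rightarrow> config \<Rightarrow> config \<Rightarrow> bool" where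
  "step_rel M c d \<longleftrightarrow> fst c < num_states M \<and> first_cell (snd (snd c)) < num_symbols M \<and> d = machine_step M c"

lemma computable_first_cell [re]:
  assumes "computable f" shows "computable (\<lambda>x. first_cell (f x))"
proof (rule computable_graph1[OF _ assms])
  have "RE (\<lambda>z. fst z = [] \<and> snd z = 0 \<or> (\<exists>r. fst z = snd z # r))" by (intro re)
  then show "RE (\<lambda>(r, a). a = first_cell r)"
  proof (rule RE_cong)
    show "(case z of (r, a) \<Rightarrow> a = first_cell r) \<longleftrightarrow> fst z = [] \<and> snd z = 0 \<or> (\<exists>r. fst z = snd z # r)" for z
      by (cases z; cases "fst z") (auto simp: first_cell_def)
  qed
qed

lemma computable_tl [re]:
  assumes "computable f" shows "computable (\<lambda>x. tl (f x))"
proof (rule computable_graph1[OF _ assms])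
  have "RE (\<lambda>z. fst z = [] \<and> snd z = [] \<or> (\<exists>a. fst z = a # snd z))" by (intro re)
  then show "RE (\<lambda>(r, s). s = tl r)"
  proof (rule RE_cong)
    show "(case z of (r, s) \<Rightarrow> s = tl r) \<longleftrightarrow> fst z = [] \<and> snd z = [] \<or> (\<exists>a. fst z = a # snd z)" for z
      by (cases z; cases "fst z") auto
  qed
qed

lemma RE_step_rel: "RE (\<lambda>(c, d). step_rel M c d)"
proof -
  let ?A = "{..<num_states M} \<times> {..<num_symbols M}"
  \<comment> \<open>For a fixed state and symbol the table entry is a constant, and the step is an
    explicit rearrangement of the tape.\<close>
  have "RE (\<lambda>z. \<exists>a \<in> ?A. fst (fst z) = fst a \<and> first_cell (snd (snd (fst z))) = snd a \<and>
      snd z = machine_step M (fst (fst z), fst (snd (fst z)), snd (snd (fst z))))"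
  proof (rule RE_finite_ex)
    fix a assume "a \<in> ?A"
    obtain q s where a: "a = (q, s)" by (cases a)
    obtain q' s' d where t: "trans_fun M q s = (q', s', d)" by (cases "trans_fun M q s")
    have "RE (\<lambda>z. fst (fst z) = q \<and> first_cell (snd (snd (fst z))) = s \<and>
      snd z = (if q = halt_state M then (q, fst (snd (fst z)), snd (snd (fst z)))
        else case d of Go_Left \<Rightarrow> (q', tl (fst (snd (fst z))), first_cell (fst (snd (fst z))) # s' # tl (snd (snd (fst z))))
          | Go_Right \<Rightarrow> (q', s' # fst (snd (fst z)), tl (snd (snd (fst z))))))" (is "RE ?explicit")
      by (cases "q = halt_state M"; cases d; simp only: simp_thms if_True if_False move.case; intro re)
    then show "RE (\<lambda>z. fst (fst z) = fst a \<and> first_cell (snd (snd (fst z))) = snd a \<and>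
      snd z = machine_step M (fst (fst z), fst (snd (fst z)), snd (snd (fst z))))" (is "RE ?step")
    proof (rule RE_cong)
      fix z :: "config \<times> config"
      obtain p l r c where "z = ((p, l, r), c)" by (metis surj_pair)
      then show "?step z \<longleftrightarrow> ?explicit z" by (cases d; simp add: a t cong: conj_cong)
    qed
  qed simp
  then show ?thesis
    by (rule RE_cong) (auto simp: step_rel_def)
qed

text \<open>The invariant that keeps runs of a well-formed machine inside its table, where
  \<open>step_rel\<close> follows \<open>machine_step\<close>.\<close>

definition proper :: "turing_machine \<Rightarrow> config \<Rightarrow> bool" where
  "proper M c \<longleftrightarrow> fst c < num_states M \<and>
    set (fst (snd c)) \<subseteq> {..<num_symbols M} \<and> set (snd (snd c)) \<subseteq> {..<num_symbols M}"

lemma first_cell_less: "wf_machine M \<Longrightarrow> set r \<subseteq> {..<num_symbols M} \<Longrightarrow> first_cell r < num_symbols M"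
  by (cases r) (auto simp: first_cell_def wf_machine_def)

lemma set_tl_subset: "set r \<subseteq> A \<Longrightarrow> set (tl r) \<subseteq> A"
  by (cases r) auto

lemma proper_step:
  assumes "wf_machine M" "proper M c"
  shows "step_rel M c (machine_step M c)" "proper M (machine_step M c)"
proof -
  obtain q l r where c: "c = (q, l, r)" by (cases c)
  have q: "q < num_states M" and l: "set l \<subseteq> {..<num_symbols M}" and r: "set r \<subseteq> {..<num_symbols M}"
    using assms(2) by (auto simp: c proper_def)
  note cells = first_cell_less[OF assms(1) l] first_cell_less[OF assms(1) r]
  then show "step_rel M c (machine_step M c)" using q by (simp add: step_rel_def c)
  obtain q' s' d where t: "trans_fun M q (first_cell r) = (q', s', d)" by (cases "trans_fun M q (first_cell r)")
  have "case trans_fun M q (first_cell r) of (q', s', d) \<Rightarrow> q' < num_states M \<and> s' < num_symbols M"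
    using assms(1) q cells(2) by (simp add: wf_machine_def)
  then show "proper M (machine_step M c)"
    using q l r cells set_tl_subset[OF l] set_tl_subset[OF r]
    by (cases "q = halt_state M"; cases d; simp add: c t proper_def)
qed

lemma proper_init: "wf_machine M \<Longrightarrow> proper M (init_config M w)"
  by (auto simp: proper_def init_config_def wf_machine_def bit_symbol_def)

lemma run_step_rel:
  assumes "wf_machine M" "proper M c"
  shows "(step_rel M)\<^sup>*\<^sup>* c ((machine_step M ^^ n) c)"
proof -
  have "proper M ((machine_step M ^^ k) c)" for k
    by (induction k) (auto simp del: machine_step.simps intro: assms proper_step)
  then show ?thesis
    by (induction n) (auto simp del: machine_step.simps intro: rtranclp.rtrancl_into_rtrancl proper_step(1)[OF assms(1)])
qed

lemma step_rel_run: "(step_rel M)\<^sup>*\<^sup>* c d \<Longrightarrow> \<exists>n. d = (machine_step M ^^ n) c"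
proof (induction rule: rtranclp_induct)
  case base
  then show ?case by (intro exI[of _ 0]) simp
next
  case (step d e)
  then obtain n where "d = (machine_step M ^^ n) c" by blast
  with step show ?case by (intro exI[of _ "Suc n"]) (simp add: step_rel_def)
qed

lemma halted_run: "fst c = halt_state M \<Longrightarrow> (machine_step M ^^ n) c = c"
  by (induction n) (cases c; simp)+

text \<open>Halted configurations are fixed points, so both runs agree with the run of m + n
  steps.\<close>

lemma run_halt_unique:
  assumes "fst ((machine_step M ^^ m) c) = halt_state M" "fst ((machine_step M ^^ n) c) = halt_state M"
  shows "(machine_step M ^^ m) c = (machine_step M ^^ n) c"
proof -
  have "(machine_step M ^^ (m + n)) c = (machine_step M ^^ n) c"
    using halted_run[OF assms(2)] by (simp add: funpow_add)
  moreover have "(machine_step M ^^ (n + m)) c = (machine_step M ^^ m) c"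
    using halted_run[OF assms(1)] by (simp add: funpow_add)
  ultimately show ?thesis by (simp add: add.commute)
qed

text \<open>The blank 0 is not a bit symbol, so the first blank marks the end of the output.\<close>

lemma output_unique:
  assumes "map bit_symbol v @ r = map bit_symbol v' @ r'" "first_cell r = 0" "first_cell r' = 0"
  shows "v = v'"
  using assms(1)
proof (induction v arbitrary: v')
  case Nil
  then show ?case using assms(2) by (cases v') (auto simp: first_cell_def bit_symbol_def split: if_splits)
next
  case (Cons b v)
  show ?case
  proof (cases v')
    case Nil
    then show ?thesis using Cons.prems assms(3) by (auto simp: first_cell_def bit_symbol_def split: if_splits)
  next
    case (Cons b' u)
    with Cons.prems Cons.IH[of u] show ?thesis by (auto simp: bit_symbol_def split: if_splits)
  qed
qed

lemma computable_bit_symbol: "computable bit_symbol"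
proof (rule computableI)
  have "RE (\<lambda>z. fst z = True \<and> snd z = 2 \<or> fst z = False \<and> snd z = (1 :: nat))" by (intro re)
  then show "RE (\<lambda>z. snd z = bit_symbol (fst z))"
    by (rule RE_cong) (auto simp: bit_symbol_def)
qed

text \<open>The graph consists of the pairs (w, v) for which a halted configuration displaying v can
  be reached; v is the right value because the halted configuration and its output are
  unique.\<close>

lemma computable_polytime:
  assumes "polytime f"
  shows "computable f"
proof (rule computableI)
  from assms obtain M where M: "wf_machine M"
    "\<And>w. \<exists>n. halts_with M ((machine_step M ^^ n) (init_config M w)) (f w)"
    unfolding polytime_def by blast
  have reach: "RE (\<lambda>x. (step_rel M)\<^sup>*\<^sup>* (g x) (h x))" if "computable g" "computable h"
    for g h :: "'a :: enc \<Rightarrow> config"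
    by (rule RE_comp2[OF _ that]) (use RE_rtranclp[OF RE_step_rel] in \<open>simp add: case_prod_beta'\<close>)
  have "RE (\<lambda>z. \<exists>l r. (step_rel M)\<^sup>*\<^sup>* (start_state M, [], map bit_symbol (fst z))
      (halt_state M, l, map bit_symbol (snd z) @ r) \<and> first_cell r = 0)"
    by (intro re reach computable_bit_symbol)
  then show "RE (\<lambda>z. snd z = f (fst z))"
  proof (rule RE_cong)
    fix z :: "bool list \<times> bool list"
    obtain w v where z: "z = (w, v)" by (cases z)
    have "v = f w \<longleftrightarrow> (\<exists>d. (step_rel M)\<^sup>*\<^sup>* (init_config M w) d \<and> halts_with M d v)"
    proof
      assume "v = f w"
      then show "\<exists>d. (step_rel M)\<^sup>*\<^sup>* (init_config M w) d \<and> halts_with M d v"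
        using M(2)[of w] run_step_rel[OF M(1) proper_init[OF M(1)]] by blast
    next
      assume "\<exists>d. (step_rel M)\<^sup>*\<^sup>* (init_config M w) d \<and> halts_with M d v"
      then obtain m where m: "halts_with M ((machine_step M ^^ m) (init_config M w)) v"
        using step_rel_run by blast
      obtain n where n: "halts_with M ((machine_step M ^^ n) (init_config M w)) (f w)"
        using M(2) by blast
      have "(machine_step M ^^ m) (init_config M w) = (machine_step M ^^ n) (init_config M w)"
        by (rule run_halt_unique) (use m n in \<open>auto simp: halts_with_def\<close>)
      with m n show "v = f w" unfolding halts_with_def by (metis Pair_inject output_unique)
    qed
    then show "snd z = f (fst z) \<longleftrightarrow> (\<exists>l r. (step_rel M)\<^sup>*\<^sup>* (start_state M, [], map bit_symbol (fst z))
      (halt_state M, l, map bit_symbol (snd z) @ r) \<and> first_cell r = 0)"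
      by (auto simp: z init_config_def halts_with_def)
  qed
qed

section \<open>The arithmetical hierarchy\<close>

text \<open>The function e packs the arguments into one number; it is composed with
  \<open>tl\<close> because the witness of the projection stands at the head of the list.\<close>

lemma Sigma_1:
  assumes "RE0 P" "rfun (Suc n) (\<lambda>xs. e (tl xs))"
  shows "Sigma_rel 1 n (\<lambda>xs. P (e xs))"
proof -
  obtain f where f: "cmp f" "\<And>x. P x \<longleftrightarrow> (\<exists>y. f (pair y x) = 0)"
    using assms(1) unfolding RE0_def by blast
  let ?P = "\<lambda>xs. f (pair (hd xs) (e (tl xs))) = 0"
  \<comment> \<open>Double truncated subtraction normalises to 0 or 1, giving the characteristic
    function of the complement of \<open>?P\<close>, which is what \<open>Sigma_rel\<close> asks
    for.\<close>
  have "rfun (Suc n) (\<lambda>xs. 1 - (1 - f (pair (hd xs) (e (tl xs)))))"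
    by (intro rfun_diff rfun_const rfun_cmp[OF f(1)] rfun_pair rfun_hd assms(2)) simp
  then obtain g where "recursive_fun (Suc n) g"
    "\<And>xs. length xs = Suc n \<Longrightarrow> 1 - (1 - f (pair (hd xs) (e (tl xs)))) = g xs"
    unfolding rfun_def by blast
  then have "recursive_rel (Suc n) (\<lambda>xs. \<not> ?P xs)"
    unfolding recursive_rel_def by (intro exI[of _ g]) force
  then show ?thesis unfolding One_nat_def Sigma_rel.simps by (intro exI[of _ ?P]) (simp add: f(2))
qed

lemma RE_nat_iff: "RE (P :: nat \<Rightarrow> bool) \<longleftrightarrow> RE0 P"
  by (simp add: RE_def enc_nat_def)

lemma Sigma_class_1:
  assumes "RE (\<lambda>w. w \<in> A)"
  shows "A \<in> Sigma_class 1"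
proof -
  have "RE (\<lambda>n. \<exists>w. n = str_code w \<and> w \<in> A)"
    by (intro re RE_snd assms)
  then have "RE0 (\<lambda>n. n \<in> str_code ` A)"
    unfolding RE_nat_iff image_iff by (rule back_subst[of RE0]) auto
  moreover have "rfun (Suc 1) (\<lambda>xs. hd (tl xs))"
    by (rule rfun_cong[OF rfun_nth[of 1]]) (auto simp: length_Suc_conv)
  ultimately show ?thesis unfolding Sigma_class_def using Sigma_1[of _ 1 hd] by simp
qed

lemma Sigma_class_3:
  assumes "RE (\<lambda>(w, N, M). S w N (M :: nat))" and "\<And>w. w \<in> A \<longleftrightarrow> (\<exists>N :: nat. \<forall>M. S w N M)"
  shows "A \<in> Sigma_class 3"
proof -
  define Q where "Q n N M \<longleftrightarrow> (\<exists>w. n = str_code w \<and> S w N M)" for n N M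
  have "RE (\<lambda>z. \<exists>w. fst z = str_code w \<and> (\<lambda>(w, N, M). S w N M) (w, fst (snd z), snd (snd z)))"
    by (intro re RE_comp[OF assms(1)])
  then have RE_Q: "RE0 (\<lambda>z. Q (pfst z) (pfst (psnd z)) (psnd (psnd z)))"
    unfolding RE_def by (simp add: Q_def enc_Pair enc_nat_def eq_pair_iff cong: conj_cong)
  \<comment> \<open>Each projection puts its witness at the head, so the list reads: search witness,
    M, N, code of w.\<close>
  have "rfun (Suc 3) (\<lambda>xs. pair (tl xs ! 2) (pair (tl xs ! 1) (tl xs ! 0)))"
    by (intro rfun_pair) (rule rfun_cong[OF rfun_nth[of 3]] rfun_cong[OF rfun_nth[of 2]] rfun_cong[OF rfun_nth[of 1]];
      auto simp: nth_tl numeral_eq_Suc)+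
  from Sigma_1[OF RE_Q this] have 1: "Sigma_rel 1 3 (\<lambda>xs. Q (xs ! 2) (xs ! 1) (xs ! 0))" by simp
  \<comment> \<open>The failure of the universal statement is witnessed by an M for which Q fails, a
    Pi_1 condition since Q is Sigma_1.\<close>
  have "Sigma_rel 2 (Suc 1) (\<lambda>xs. \<not> (\<forall>M. Q (xs ! 1) (xs ! 0) M))"
    unfolding numeral_2_eq_2 Sigma_rel.simps(2)[of "Suc 0"]
    by (rule exI[of _ "\<lambda>xs. \<not> Q (xs ! 2) (xs ! 1) (xs ! 0)"])
      (use 1 in \<open>simp add: numeral_eq_Suc\<close>)
  then have "Sigma_rel (Suc 2) 1 (\<lambda>xs. \<exists>N. \<forall>M. Q (hd xs) N M)"
    unfolding Sigma_rel.simps(2)[of 2]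
    by (intro exI[of _ "\<lambda>xs. \<forall>M. Q (xs ! 1) (xs ! 0) M"])
      (clarsimp simp: length_Suc_conv simp flip: numeral_2_eq_2)
  moreover have "n \<in> str_code ` A \<longleftrightarrow> (\<exists>N. \<forall>M. Q n N M)" for n
  proof -
    have inj: "inj str_code" using bij_str_code by (rule bij_is_inj)
    obtain w where n: "n = str_code w" using bij_is_surj[OF bij_str_code] by (metis surj_def)
    have "Q n N M \<longleftrightarrow> S w N M" for N M using inj by (auto simp: Q_def n inj_eq)
    then show ?thesis using inj by (simp add: n inj_image_mem_iff assms(2))
  qed
  ultimately show ?thesis by (simp add: Sigma_class_def numeral_3_eq_3 numeral_2_eq_2)
qed

theorem theorem12:
  "exists_R_exp_less \<subseteq> Sigma_class 1 \<and> exists_R_exp \<subseteq> Sigma_class 3"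
proof (intro conjI subsetI)
  fix A assume "A \<in> exists_R_exp_less"
  then obtain f where f: "computable f" "\<And>w. w \<in> A \<longleftrightarrow> f w \<in> ETR_exp_less"
    unfolding exists_R_exp_less_def polytime_reducible_def by (blast dest: computable_polytime)
  have "RE (\<lambda>w. \<exists>p N. f w = fm_code p \<and> eq_free p \<and> sentence p \<and> approx N N [] p)"
    by (intro re RE_comp[OF RE_eq_free] RE_comp[OF RE_sentence] computable_comp[OF f(1)])
  then have "RE (\<lambda>w. w \<in> A)"
    unfolding f(2) ETR_exp_less_def true_sentence_iff mem_Collect_eq
    by (rule RE_cong) (use fm_holds_iff_approx_diagonal in blast)
  then show "A \<in> Sigma_class 1" by (rule Sigma_class_1)
next
  fix A assume "A \<in> exists_R_exp"
  then obtain f where f: "computable f" "\<And>w. w \<in> A \<longleftrightarrow> f w \<in> ETR_exp"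
    unfolding exists_R_exp_def polytime_reducible_def by (blast dest: computable_polytime)
  let ?S = "\<lambda>w N M. \<exists>p. f w = fm_code p \<and> sentence p \<and> approx N M [] p"
  show "A \<in> Sigma_class 3"
  proof (rule Sigma_class_3[where S = ?S])
    have "RE (\<lambda>z. ?S (fst z) (fst (snd z)) (snd (snd z)))"
      by (intro re RE_comp[OF RE_sentence] computable_comp[OF f(1)])
    then show "RE (\<lambda>(w, N, M). ?S w N M)" by (simp add: case_prod_beta')
    \<comment> \<open>Injectivity of \<open>fm_code\<close> makes p the same for all N and M; if
      \<open>f w\<close> is no code word, both sides are false.\<close>
    show "w \<in> A \<longleftrightarrow> (\<exists>N. \<forall>M. ?S w N M)" for w
    proof (cases "\<exists>p. f w = fm_code p")
      case True
      then obtain p where "f w = fm_code p" ..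
      then show ?thesis
        by (auto simp: f(2) ETR_exp_def true_sentence_iff fm_holds_iff_approx fm_code_eq_iff)
    qed (auto simp: f(2) ETR_exp_def)
  qed
qed

end
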